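(* Let $n\ge 1$. For a mid-convex function $f:D\to\mathbb{R}$ defined on a non-empty open convex set $D\subset\mathbb{R}^n$, the following conditions are equivalent: (1) $f$ is continuous; (2) $f$ is upper bounded on some non-flat continuum $K\subset D$; (3) $f$ is upper bounded on some non-meager analytic subspace of a nowhere flat locally connected subset of $D$, i.e. there are a nowhere flat locally connected set $K\subset D$ and an analytic subspace $A\subset K$, non-meager in $K$, such that $f$ is upper bounded on $A$.
   Context: A function $f:D\to\mathbb{R}$ on a convex set $D$ is mid-convex if $f\big(\tfrac{x+y}{2}\big)\le\tfrac{f(x)+f(y)}{2}$ for all $x,y\in D$. A continuum is a connected compact metrizable space. A subset $A$ of $\mathbb{R}^n$ is flat if its affine hull is nowhere dense in $\mathbb{R}^n$ (equivalently, is not all of $\mathbb{R}^n$); $A$ is nowhere flat if each non-empty relatively open subset $U\subset A$ is not flat in $\mathbb{R}^n$. A subspace of $\mathbb{R}^n$ is analytic if it is a continuous image of a Polish space (or empty). "Non-meager in $K$" means not of first category in the space $K$ with its subspace topology. $f$ is upper bounded on $T$ if $\sup f(T)<\infty$. *)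

theory Defs
  imports "HOL-Analysis.Analysis"
begin

definition mid_convex_on :: "'a::real_vector set \<Rightarrow> ('a \<Rightarrow> real) \<Rightarrow> bool" where
  "mid_convex_on D f \<longleftrightarrow> (\<forall>x\<in>D. \<forall>y\<in>D. f (midpoint x y) \<le> (f x + f y) / 2)"

text \<open>Metrizability is automatic for the subsets of a metric space considered here.\<close>

definition continuum :: "'a::metric_space set \<Rightarrow> bool" where
  "continuum K \<longleftrightarrow> K \<noteq> {} \<and> compact K \<and> connected K"

definition nowhere_dense_in :: "'a topology \<Rightarrow> 'a set \<Rightarrow> bool" where
  "nowhere_dense_in X S \<longleftrightarrow> S \<subseteq> topspace X \<and> X interior_of (X closure_of S) = {}"

definition meager_in :: "'a topology \<Rightarrow> 'a set \<Rightarrow> bool" where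
  "meager_in X S \<longleftrightarrow>
     (\<exists>\<N>. countable \<N> \<and> (\<forall>N\<in>\<N>. nowhere_dense_in X N) \<and> S = \<Union>\<N>)"

definition flat :: "(real ^ 'n) set \<Rightarrow> bool" where
  "flat A \<longleftrightarrow> nowhere_dense_in euclidean (affine hull A)"

definition nowhere_flat :: "(real ^ 'n) set \<Rightarrow> bool" where
  "nowhere_flat A \<longleftrightarrow>
     (\<forall>U. openin (top_of_set A) U \<and> U \<noteq> {} \<longrightarrow> \<not> flat U)"

definition Polish_space :: "'a topology \<Rightarrow> bool" where
  "Polish_space X \<longleftrightarrow> completely_metrizable_space X \<and> second_countable X"

text \<open>
  A definition cannot quantify over the type of points of the Polish space.  Every Polish space
  has at most continuum many points, so it suffices to consider those whose points are real
  numbers (with an arbitrary topology); \<open>analytic_setI\<close> below shows that Polish spaces over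
  other types yield no further sets.  The carrier \<open>topspace X\<close> may be empty.
\<close>

definition analytic_set :: "'a::topological_space set \<Rightarrow> bool" where
  "analytic_set A \<longleftrightarrow>
     (\<exists>(X :: real topology) g. Polish_space X \<and> continuous_map X euclidean g
        \<and> g ` topspace X = A)"

lemma Polish_space_lepoll_reals:
  assumes "Polish_space X"
  shows "topspace X \<lesssim> (UNIV :: real set)"
proof -
  from assms obtain \<B> where \<B>: "countable \<B>" "\<And>V. V \<in> \<B> \<Longrightarrow> openin X V"
    "\<And>U x. openin X U \<Longrightarrow> x \<in> U \<Longrightarrow> \<exists>V\<in>\<B>. x \<in> V \<and> V \<subseteq> U"
    unfolding Polish_space_def second_countable_def by metis
  have t1: "t1_space X"
    using assms by (simp add: Polish_space_def completely_metrizable_imp_metrizable_space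
        metrizable_imp_t1_space)
  define h where "h x = to_nat_on \<B> ` {V \<in> \<B>. x \<in> V}" for x
  have "inj_on h (topspace X)"
  proof (rule inj_onI, rule ccontr)
    fix x y assume x: "x \<in> topspace X" and y: "y \<in> topspace X"
      and eq: "h x = h y" and "x \<noteq> y"
    then obtain U where "openin X U" "x \<in> U" "y \<notin> U"
      using t1 unfolding t1_space_def by metis
    then obtain V where V: "V \<in> \<B>" "x \<in> V" "y \<notin> V"
      using \<B>(3) by blast
    then have "to_nat_on \<B> V \<in> h y"
      using eq unfolding h_def by blast
    then obtain W where "W \<in> \<B>" "y \<in> W" "to_nat_on \<B> V = to_nat_on \<B> W"
      unfolding h_def by blast
    with V \<B>(1) show False by simp
  qed
  then have "topspace X \<lesssim> (UNIV :: nat set set)"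
    unfolding lepoll_def by blast
  also have "\<dots> \<approx> (UNIV :: real set)"
    by (rule nat_sets_eqpoll_reals)
  finally show ?thesis .
qed

lemma analytic_setI:
  fixes X :: "'b topology" and A :: "'a::topological_space set"
  assumes X: "Polish_space X" and g: "continuous_map X euclidean g" and A: "g ` topspace X = A"
  shows "analytic_set A"
proof -
  obtain h :: "'b \<Rightarrow> real" where h: "inj_on h (topspace X)"
    using Polish_space_lepoll_reals[OF X] unfolding lepoll_def by blast
  define k where "k = inv_into (topspace X) h"
  define Y where "Y = pullback_topology (h ` topspace X) k X"
  have kh: "k (h x) = x" if "x \<in> topspace X" for x
    using h that by (simp add: k_def)
  have topY: "topspace Y = h ` topspace X"
    using kh by (auto simp: Y_def topspace_pullback_topology)
  have contk: "continuous_map Y X k"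
    unfolding Y_def
    using continuous_map_pullback[OF continuous_map_id, where f = k and A = "h ` topspace X"]
    by (simp only: id_comp)
  have conth: "continuous_map X Y h"
    unfolding Y_def
  proof (rule continuous_map_pullback')
    show "continuous_map X X (k \<circ> h)"
      by (rule continuous_map_eq[OF continuous_map_id]) (simp add: kh)
  qed auto
  have "homeomorphic_maps X Y h k"
    unfolding homeomorphic_maps_def using contk conth kh topY by auto
  then have "X homeomorphic_space Y"
    by (rule homeomorphic_maps_imp_homeomorphic_space)
  then have "Polish_space Y"
    using X homeomorphic_completely_metrizable_space homeomorphic_space_second_countability
    unfolding Polish_space_def by blast
  moreover have "continuous_map Y euclidean (g \<circ> k)"
    using contk g by (rule continuous_map_compose)
  moreover have "(g \<circ> k) ` topspace Y = A"
    using A kh by (auto simp: topY image_image)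
  ultimately show ?thesis
    unfolding analytic_set_def by blast
qed

end

theory Submission
  imports Defs
begin

text \<open>
  The sublevel set \<open>T = {x \<in> D. f x \<le> M}\<close> is closed under midpoints, so for suitable \<open>c\<close> and positive
  weights \<open>w\<^sub>i\<close> it contains \<open>c + \<Sum>i. w\<^sub>i x\<^sub>i\<close> for all \<open>x\<^sub>i \<in> T\<close>, where \<open>i\<close> runs through the \<open>n\<close> coordinate
  indices. By the Bernstein--Doetsch theorem it is enough that \<open>T\<close> has interior points.

  If \<open>K\<^sub>1, \<dots>, K\<^sub>n\<close> are non-flat continua, choose \<open>a\<^sub>i, a\<^sub>i + b\<^sub>i \<in> K\<^sub>i\<close> with \<open>b\<^sub>1, \<dots>, b\<^sub>n\<close> linearly
  independent. Then the sumset \<open>S\<close> of the \<open>K\<^sub>i\<close> satisfies \<open>S + \<Sum>i. \<int> b\<^sub>i = \<real>\<^sup>n\<close>: for paths from \<open>a\<^sub>i\<close> to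
  \<open>a\<^sub>i + b\<^sub>i\<close> this is Brouwer's fixed point theorem, and continua are limits of such paths. So \<open>S\<close>
  has interior points by Baire's theorem.

  If \<open>A\<close> is non-meager in a nowhere flat locally connected set \<open>K\<close> and countably many closed sets
  cover the weighted sums of \<open>A\<close>, then one of them contains the weighted sums of relatively open
  subsets of \<open>K\<close>, which can be taken connected and bounded; their closures are non-flat continua.
  Thus the weighted sums of \<open>A\<close> are non-meager. As they form an analytic set, they are comeager in
  some non-empty open set, all of whose points are midpoints of weighted sums (Piccard--Pettis).
\<close>

subsection \<open>Meager sets\<close>

text \<open>An affine hull in finite dimension is closed, and if it has interior points it contains
  the affine hull of a non-empty open set, which is the whole space.\<close>

lemma not_flat_iff: "\<not> flat A \<longleftrightarrow> affine hull A = UNIV"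
proof
  assume "\<not> flat A"
  then have "interior (affine hull A) \<noteq> {}"
    by (simp add: flat_def nowhere_dense_in_def closure_affine_hull)
  then have "affine hull (interior (affine hull A)) = UNIV"
    by (simp add: affine_hull_open)
  moreover have "affine hull (interior (affine hull A)) \<subseteq> affine hull A"
    by (metis hull_hull hull_mono interior_subset)
  ultimately show "affine hull A = UNIV"
    by blast
qed (simp add: flat_def nowhere_dense_in_def)

text \<open>Closures turn nowhere dense pieces into closed sets without interior; conversely the
  traces of such sets on \<open>S\<close> are nowhere dense. Asking only for a cover makes heredity
  to subsets immediate.\<close>

lemma meager_in_euclidean_iff:
  "meager_in euclidean S \<longleftrightarrow>
    (\<exists>\<N>. countable \<N> \<and> (\<forall>N\<in>\<N>. closed N \<and> interior N = {}) \<and> S \<subseteq> \<Union>\<N>)"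
proof
  assume "meager_in euclidean S"
  then obtain \<N> where "countable \<N>" "\<And>N. N \<in> \<N> \<Longrightarrow> interior (closure N) = {}" "S = \<Union>\<N>"
    by (auto simp: meager_in_def nowhere_dense_in_def)
  then show "\<exists>\<N>. countable \<N> \<and> (\<forall>N\<in>\<N>. closed N \<and> interior N = {}) \<and> S \<subseteq> \<Union>\<N>"
    using closure_subset by (intro exI[of _ "closure ` \<N>"]) (fastforce)
next
  assume "\<exists>\<N>. countable \<N> \<and> (\<forall>N\<in>\<N>. closed N \<and> interior N = {}) \<and> S \<subseteq> \<Union>\<N>"
  then obtain \<N> where \<N>: "countable \<N>" "\<And>N. N \<in> \<N> \<Longrightarrow> closed N \<and> interior N = {}" "S \<subseteq> \<Union>\<N>"
    by blast
  have "interior (closure (S \<inter> N)) = {}" if "N \<in> \<N>" for N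
    using \<N>(2)[OF that] closure_minimal[of "S \<inter> N" N] interior_mono[of "closure (S \<inter> N)" N] by auto
  with \<N> show "meager_in euclidean S"
    unfolding meager_in_def nowhere_dense_in_def
    by (intro exI[of _ "(\<inter>) S ` \<N>"]) auto
qed

lemma meager_subset: "meager_in euclidean T \<Longrightarrow> S \<subseteq> T \<Longrightarrow> meager_in euclidean S"
  unfolding meager_in_euclidean_iff by (meson subset_trans)

lemma meager_UN:
  assumes "countable I" "\<And>i. i \<in> I \<Longrightarrow> meager_in euclidean (S i)"
  shows "meager_in euclidean (\<Union>i\<in>I. S i)"
proof -
  obtain \<N> where "\<And>i. i \<in> I \<Longrightarrow> countable (\<N> i) \<and> (\<forall>N\<in>\<N> i. closed N \<and> interior N = {}) \<and> S i \<subseteq> \<Union>(\<N> i)"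
    using assms(2) unfolding meager_in_euclidean_iff by metis
  then show ?thesis
    using assms(1) unfolding meager_in_euclidean_iff by (intro exI[of _ "\<Union>i\<in>I. \<N> i"]) fastforce
qed

lemma meager_Un:
  "meager_in euclidean S \<Longrightarrow> meager_in euclidean T \<Longrightarrow> meager_in euclidean (S \<union> T)"
  using meager_UN[of "{S,T}" "\<lambda>x. x"] by auto

lemma meager_nowhere_dense: "interior (closure S) = {} \<Longrightarrow> meager_in euclidean S"
  unfolding meager_in_euclidean_iff
  by (intro exI[of _ "{closure S}"]) (simp add: closure_subset)

text \<open>This is Baire's theorem in Euclidean space.\<close>

lemma meager_open_imp_empty:
  fixes U :: "'a::euclidean_space set"
  assumes "meager_in euclidean U" "open U"
  shows "U = {}"
proof -
  obtain \<N> where \<N>: "countable \<N>" "\<And>N. N \<in> \<N> \<Longrightarrow> closed N \<and> interior N = {}" "U \<subseteq> \<Union>\<N>"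
    using assms(1) unfolding meager_in_euclidean_iff by blast
  have "euclidean interior_of \<Union>\<N> = {}"
    by (rule Baire_category_alt) (use \<N> completely_metrizable_space_euclidean in auto)
  then show ?thesis
    using interior_maximal[OF \<N>(3) assms(2)] by simp
qed

text \<open>Affine bijections preserve closedness and empty interior; the case \<open>c = -1\<close>
  is a point reflection.\<close>

lemma meager_affinity:
  fixes S :: "'a::euclidean_space set"
  assumes "meager_in euclidean S" "c \<noteq> 0"
  shows "meager_in euclidean ((\<lambda>x. a + c *\<^sub>R x) ` S)"
proof -
  obtain \<N> where \<N>: "countable \<N>" "\<And>N. N \<in> \<N> \<Longrightarrow> closed N \<and> interior N = {}" "S \<subseteq> \<Union>\<N>"
    using assms(1) unfolding meager_in_euclidean_iff by blast
  have "closed ((\<lambda>x. a + c *\<^sub>R x) ` N) \<and> interior ((\<lambda>x. a + c *\<^sub>R x) ` N) = {}" if "N \<in> \<N>" for N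
  proof -
    have eq: "(\<lambda>x. a + c *\<^sub>R x) ` N = (+) a ` (*\<^sub>R) c ` N"
      by (simp add: image_image)
    have "interior ((*\<^sub>R) c ` N) = (*\<^sub>R) c ` interior N"
      using assms(2) by (intro interior_injective_linear_image) (auto simp: inj_on_def)
    with \<N>(2)[OF that] show ?thesis
      unfolding eq by (simp add: closed_translation closed_scaling interior_translation)
  qed
  with \<N> show ?thesis
    unfolding meager_in_euclidean_iff
    by (intro exI[of _ "image (\<lambda>x. a + c *\<^sub>R x) ` \<N>"]) fastforce
qed

subsection \<open>Continuous images of Polish spaces\<close>

text \<open>The largest open set in no non-empty open subset of which \<open>E\<close> is meager.\<close>

definition essential_interior :: "'a::topological_space set \<Rightarrow> 'a set" where
  "essential_interior E = - closure (\<Union>{W. open W \<and> meager_in euclidean (E \<inter> W)})"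

lemma open_essential_interior: "open (essential_interior E)"
  unfolding essential_interior_def by (intro open_Compl closed_closure)

lemma not_meager_essential_interior:
  assumes "open W" "W \<noteq> {}" "W \<subseteq> essential_interior E"
  shows "\<not> meager_in euclidean (E \<inter> W)"
proof
  assume "meager_in euclidean (E \<inter> W)"
  then have "W \<subseteq> \<Union>{W. open W \<and> meager_in euclidean (E \<inter> W)}"
    using assms(1) by blast
  with assms(2,3) closure_subset show False
    unfolding essential_interior_def by blast
qed

text \<open>Banach's category theorem. By Lindelof, countably many of the open sets in which
  \<open>E\<close> is meager have the same union; the rest of \<open>E\<close> outside the essential
  interior lies in the frontier of that open union, which is nowhere dense.\<close>

lemma meager_Diff_essential_interior:
  fixes E :: "'a::second_countable_topology set"
  shows "meager_in euclidean (E - essential_interior E)"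
proof -
  define \<W> where "\<W> = {W. open W \<and> meager_in euclidean (E \<inter> W)}"
  obtain \<W>' where \<W>': "\<W>' \<subseteq> \<W>" "countable \<W>'" "\<Union>\<W>' = \<Union>\<W>"
    using Lindelof[of \<W>] unfolding \<W>_def by blast
  have 1: "meager_in euclidean (\<Union>W\<in>\<W>'. E \<inter> W)"
    using \<W>' by (intro meager_UN) (auto simp: \<W>_def)
  have op: "open (\<Union>\<W>)"
    unfolding \<W>_def by blast
  have "interior (frontier (\<Union>\<W>)) \<inter> \<Union>\<W> = {}"
    using op interior_subset[of "frontier (\<Union>\<W>)"] by (auto simp: frontier_def interior_open)
  then have "interior (frontier (\<Union>\<W>)) \<inter> closure (\<Union>\<W>) = {}"
    by (simp add: open_Int_closure_eq_empty)
  then have "interior (frontier (\<Union>\<W>)) = {}"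
    using interior_subset[of "frontier (\<Union>\<W>)"] by (auto simp: frontier_def)
  then have 2: "meager_in euclidean (frontier (\<Union>\<W>))"
    by (intro meager_nowhere_dense) (simp add: frontier_closed)
  have "E - essential_interior E \<subseteq> (\<Union>W\<in>\<W>'. E \<inter> W) \<union> frontier (\<Union>\<W>)"
    using \<W>'(3) op unfolding essential_interior_def \<W>_def[symmetric]
    by (auto simp: frontier_def interior_open)
  then show ?thesis
    using meager_Un[OF 1 2] meager_subset by blast
qed

text \<open>Off its closure \<open>E\<close> has empty, hence meager, trace, so no non-empty open
  part of the essential interior can lie there.\<close>

lemma essential_interior_subset_closure: "essential_interior E \<subseteq> closure E"
proof -
  let ?W = "essential_interior E - closure E"
  have "E \<inter> ?W = {}"
    using closure_subset by blast
  moreover have "meager_in euclidean {}"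
    by (rule meager_nowhere_dense) simp
  ultimately have "?W = {}"
    using not_meager_essential_interior[of ?W E] open_essential_interior[of E] by auto
  then show ?thesis by blast
qed

text \<open>The difference is even nowhere dense. Otherwise some non-empty open \<open>W\<close>
  inside the essential interior of \<open>E\<close> misses those of all \<open>S i\<close>; then
  \<open>E \<inter> W\<close> is covered by the meager sets
  \<open>S i - essential_interior (S i)\<close>.\<close>

lemma meager_essential_interior_Diff_UN:
  fixes E :: "'a::second_countable_topology set"
  assumes "countable I" "E \<subseteq> (\<Union>i\<in>I. S i)"
  shows "meager_in euclidean (essential_interior E - (\<Union>i\<in>I. essential_interior (S i)))"
proof (rule meager_nowhere_dense, rule ccontr)
  let ?R = "essential_interior E - (\<Union>i\<in>I. essential_interior (S i))"
  assume ne: "interior (closure ?R) \<noteq> {}"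
  define W where "W = interior (closure ?R) \<inter> essential_interior E"
  have "closure ?R \<subseteq> - (\<Union>i\<in>I. essential_interior (S i))"
    by (rule closure_minimal) (use open_essential_interior in \<open>auto intro!: closed_Compl\<close>)
  then have disj: "W \<inter> essential_interior (S i) = {}" if "i \<in> I" for i
    using that interior_subset[of "closure ?R"] unfolding W_def by blast
  have "interior (closure ?R) \<inter> ?R \<noteq> {}"
    using ne interior_subset[of "closure ?R"] open_Int_closure_eq_empty[of "interior (closure ?R)" ?R]
    by auto
  then have "W \<noteq> {}"
    unfolding W_def by blast
  then have "\<not> meager_in euclidean (E \<inter> W)"
    by (intro not_meager_essential_interior) (auto simp: W_def open_essential_interior)
  moreover have "meager_in euclidean (\<Union>i\<in>I. S i - essential_interior (S i))"
    using assms(1) meager_Diff_essential_interior by (rule meager_UN)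
  then have "meager_in euclidean (E \<inter> W)"
    by (rule meager_subset) (use assms(2) disj in blast)
  ultimately show False by contradiction
qed

text \<open>Split the Polish space into a tree of open sets of vanishing diameter. Outside a meager set,
  a point of the essential interior of the image of a node lies in that of the image of some child,
  hence follows a branch and is the image of the limit of that branch.\<close>

lemma Polish_image_comeager_in_open:
  fixes g :: "'b \<Rightarrow> 'a::{metric_space, second_countable_topology}"
  assumes "Polish_space X" "continuous_map X euclidean g"
    and nm: "\<not> meager_in euclidean (g ` topspace X)"
  obtains V where "open V" "V \<noteq> {}" "meager_in euclidean (V - g ` topspace X)"
proof -
  obtain M d where "Metric_space M d" and comp: "Metric_space.mcomplete M d"
    and X: "X = Metric_space.mtopology M d"
    using assms(1) unfolding Polish_space_def completely_metrizable_space_def by blast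
  then interpret Metric_space M d by simp
  obtain \<B>0 where \<B>0: "countable \<B>0" "\<And>V. V \<in> \<B>0 \<Longrightarrow> openin X V"
    "\<And>U x. openin X U \<Longrightarrow> x \<in> U \<Longrightarrow> \<exists>V\<in>\<B>0. x \<in> V \<and> V \<subseteq> U"
    using assms(1) unfolding Polish_space_def second_countable_def by metis
  \<comment> \<open>The whole space is added to the base so that it can serve as the root of the
    tree.\<close>
  define \<B> where "\<B> = insert M \<B>0"
  have \<B>: "countable \<B>" "\<And>V. V \<in> \<B> \<Longrightarrow> openin X V"
    using \<B>0 by (auto simp: \<B>_def X)
  \<comment> \<open>The children of the node \<open>U\<close> at level \<open>k\<close>: they cover
    \<open>U\<close> and lie in balls of radius \<open>1 / (k + 1)\<close>.\<close>
  define sub where "sub U k = {V \<in> \<B>. V \<subseteq> U \<and> (\<exists>c. V \<subseteq> mball c (1 / real (Suc k)))}" for U k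
  let ?G = "\<lambda>U. essential_interior (g ` U)"
  have cover: "U \<subseteq> \<Union>(sub U k)" if "U \<in> \<B>" for U k
  proof
    fix p assume p: "p \<in> U"
    then have "p \<in> M"
      using \<B>(2)[OF that] openin_subset X topspace_mtopology by blast
    moreover have "openin X (U \<inter> mball p (1 / real (Suc k)))"
      using \<B>(2)[OF that] X by auto
    ultimately obtain V where "V \<in> \<B>0" "p \<in> V" "V \<subseteq> U \<inter> mball p (1 / real (Suc k))"
      using \<B>0(3) p by (metis Int_iff centre_in_mball_iff of_nat_0_less_iff zero_less_Suc zero_less_divide_1_iff)
    then show "p \<in> \<Union>(sub U k)"
      unfolding sub_def \<B>_def by auto
  qed
  \<comment> \<open>The exceptional points, at which the choice of a child fails for some node and
    level; there are only countably many such pairs.\<close>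
  define Bad where "Bad = (\<Union>(U,k)\<in>\<B>\<times>UNIV. ?G U - (\<Union>V\<in>sub U k. ?G V))"
  have "meager_in euclidean Bad"
    unfolding Bad_def
  proof (rule meager_UN, goal_cases)
    case 1
    show ?case using \<B>(1) by blast
  next
    case (2 Uk)
    have "countable (sub (fst Uk) (snd Uk))"
      using \<B>(1) unfolding sub_def by auto
    moreover have "g ` fst Uk \<subseteq> (\<Union>V\<in>sub (fst Uk) (snd Uk). g ` V)"
      using cover[of "fst Uk" "snd Uk"] 2 by fastforce
    ultimately show ?case
      by (simp add: split_beta meager_essential_interior_Diff_UN)
  qed
  moreover have "?G M - Bad \<subseteq> g ` M"
  proof
    fix x assume x: "x \<in> ?G M - Bad"
    have "\<exists>U. \<forall>k. (U k \<in> \<B> \<and> x \<in> ?G (U k)) \<and> U (Suc k) \<in> sub (U k) k"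
    proof (rule dependent_nat_choice)
      show "\<exists>U. U \<in> \<B> \<and> x \<in> ?G U"
        using x unfolding \<B>_def by blast
      fix U k assume "U \<in> \<B> \<and> x \<in> ?G U"
      moreover have "x \<notin> ?G U - (\<Union>V\<in>sub U k. ?G V)" if "U \<in> \<B>"
        using x that unfolding Bad_def by blast
      ultimately obtain V where "V \<in> sub U k" "x \<in> ?G V" by blast
      then show "\<exists>V. (V \<in> \<B> \<and> x \<in> ?G V) \<and> V \<in> sub U k"
        unfolding sub_def by blast
    qed
    then obtain U where U: "\<And>k. U k \<in> \<B>" "\<And>k. x \<in> ?G (U k)" "\<And>k. U (Suc k) \<in> sub (U k) k"
      by blast
    have dec: "U j \<subseteq> U i" if "i \<le> j" for i j
      using that
    proof (induction rule: dec_induct)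
      case (step n)
      then show ?case using U(3)[of n] unfolding sub_def by blast
    qed simp
    \<comment> \<open>Lying in the essential interior of an image does not place \<open>x\<close> in
      that image, only in its closure; so the points \<open>p k\<close> of the branch merely have
      images tending to \<open>x\<close>.\<close>
    have "\<exists>p. p \<in> U k \<and> dist (g p) x < 1 / real (Suc k)" for k
    proof -
      have "x \<in> closure (g ` U k)"
        using U(2) essential_interior_subset_closure by blast
      then have "\<exists>y\<in>g ` U k. dist y x < 1 / real (Suc k)"
        unfolding closure_approachable by simp
      then show ?thesis by blast
    qed
    then obtain p where p: "\<And>k. p k \<in> U k" "\<And>k. dist (g (p k)) x < 1 / real (Suc k)"
      by metis
    have pM: "p k \<in> M" for k
      using p(1) \<B>(2)[OF U(1)] openin_subset X topspace_mtopology by blast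
    have "MCauchy p"
      unfolding MCauchy_def
    proof (intro conjI allI impI)
      show "range p \<subseteq> M" using pM by blast
      fix \<epsilon> :: real assume "\<epsilon> > 0"
      then obtain k where k: "1 / real (Suc k) < \<epsilon> / 2"
        using nat_approx_posE half_gt_zero by blast
      obtain c where c: "U (Suc k) \<subseteq> mball c (1 / real (Suc k))"
        using U(3)[of k] unfolding sub_def by blast
      have "d (p n) (p n') < \<epsilon>" if "Suc k \<le> n" "Suc k \<le> n'" for n n'
      proof -
        have "p n \<in> mball c (1 / real (Suc k))" "p n' \<in> mball c (1 / real (Suc k))"
          using p(1) dec that c by blast+
        then show ?thesis
          using triangle[of "p n" c "p n'"] k by (auto simp: commute)
      qed
      then show "\<exists>N. \<forall>n n'. N \<le> n \<longrightarrow> N \<le> n' \<longrightarrow> d (p n) (p n') < \<epsilon>" by blast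
    qed
    then obtain q where q: "limitin mtopology p q sequentially"
      using comp unfolding mcomplete_def by blast
    then have "q \<in> M"
      using limitin_mspace by blast
    have "limitin euclidean (g \<circ> p) (g q) sequentially"
      using continuous_map_limit[OF assms(2)] q X by blast
    then have "(\<lambda>k. g (p k)) \<longlonglongrightarrow> g q"
      by (simp add: o_def)
    moreover have "(\<lambda>k. g (p k)) \<longlonglongrightarrow> x"
    proof (rule metric_tendsto_imp_tendsto)
      show "(\<lambda>k. 1 / real (Suc k)) \<longlonglongrightarrow> 0"
        using LIMSEQ_Suc[OF lim_1_over_n] by simp
      show "\<forall>\<^sub>F k in sequentially. dist (g (p k)) x \<le> dist (1 / real (Suc k)) 0"
        using p(2) by (intro always_eventually allI) (simp add: less_imp_le)
    qed
    ultimately have "x = g q"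
      using LIMSEQ_unique by blast
    then show "x \<in> g ` M" using \<open>q \<in> M\<close> by blast
  qed
  ultimately have "meager_in euclidean (?G M - g ` topspace X)"
    by (elim meager_subset) (auto simp: X)
  moreover have "?G M \<noteq> {}"
    using meager_Diff_essential_interior[of "g ` M"] nm by (auto simp: X)
  ultimately show ?thesis
    using that open_essential_interior by blast
qed

text \<open>Reflection in \<open>x\<close> preserves balls about \<open>x\<close> and meagerness. So
  some \<open>y\<close> near \<open>x\<close> avoids both \<open>V - B\<close> and its mirror image,
  and then \<open>y\<close> and its reflection both lie in \<open>B\<close>.\<close>

lemma comeager_in_open_subset_midpoints:
  fixes B :: "'a::euclidean_space set"
  assumes "open V" "meager_in euclidean (V - B)" "x \<in> V"
  obtains y z where "y \<in> B" "z \<in> B" "x = midpoint y z"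
proof -
  obtain r where r: "r > 0" "ball x r \<subseteq> V"
    using assms(1,3) openE by blast
  let ?N = "(V - B) \<union> (\<lambda>y. 2 *\<^sub>R x + (-1) *\<^sub>R y) ` (V - B)"
  have "meager_in euclidean ?N"
    by (intro meager_Un meager_affinity assms) simp
  moreover have "\<not> meager_in euclidean (ball x r)"
    using meager_open_imp_empty[of "ball x r"] r(1) by auto
  ultimately obtain y where y: "y \<in> ball x r" "y \<notin> ?N"
    using meager_subset by blast
  define z where "z = 2 *\<^sub>R x - y"
  have "dist x z = dist x y"
    by (simp add: z_def dist_norm norm_minus_commute scaleR_2)
  then have "z \<in> V" "y \<in> V"
    using y(1) r(2) by auto
  moreover have "y = 2 *\<^sub>R x + (-1) *\<^sub>R z"
    by (simp add: z_def)
  ultimately have "y \<in> B" "z \<in> B"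
    using y(2) by auto
  moreover have "x = midpoint y z"
    by (simp add: z_def midpoint_def)
  ultimately show ?thesis using that by blast
qed

subsection \<open>Sums of continua\<close>

text \<open>Fewer than \<open>n\<close> vectors span a proper subspace. As \<open>K j\<close>
  affinely spans the space, it lies in no translate of that subspace, so two of its points differ by
  a vector outside the span.\<close>

lemma exists_independent_differences:
  fixes K :: "'n::finite \<Rightarrow> (real ^ 'n) set"
  assumes "\<And>i. affine hull (K i) = UNIV"
  shows "\<exists>a b. (\<forall>i\<in>I. a i \<in> K i \<and> a i + b i \<in> K i) \<and> inj_on b I \<and> independent (b ` I)"
  using finite[of I]
proof (induction I rule: finite_induct)
  case empty
  show ?case by (simp add: independent_empty)
next
  case (insert j I)
  then obtain a b where ab: "\<And>i. i \<in> I \<Longrightarrow> a i \<in> K i \<and> a i + b i \<in> K i" "inj_on b I"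
    "independent (b ` I)" by blast
  have "card (b ` I) < CARD('n)"
  proof -
    have "card (b ` I) < card (insert j I)"
      using insert.hyps by (simp add: card_image ab(2))
    also have "\<dots> \<le> CARD('n)" by (rule card_mono) auto
    finally show ?thesis .
  qed
  then have "dim (span (b ` I)) < CARD('n)"
    by (simp add: dim_eq_card_independent ab(3))
  then have ne: "span (b ` I) \<noteq> UNIV"
    by (metis DIM_cart DIM_real dim_UNIV less_irrefl mult.right_neutral)
  obtain p where p: "p \<in> K j"
    using assms[of j] affine_hull_empty by fastforce
  have "\<not> K j \<subseteq> (+) p ` span (b ` I)"
  proof
    assume "K j \<subseteq> (+) p ` span (b ` I)"
    then have "affine hull (K j) \<subseteq> (+) p ` span (b ` I)"
      by (intro hull_minimal) (auto simp: affine_translation[symmetric] subspace_imp_affine)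
    then have "v \<in> span (b ` I)" for v
      using assms[of j] by (metis UNIV_I add_left_imp_eq imageE subsetD)
    with ne show False by blast
  qed
  then obtain q where q: "q \<in> K j" "q - p \<notin> span (b ` I)"
    by (metis add_diff_cancel_left' diff_add_cancel add.commute image_eqI subsetI)
  let ?a = "a(j := p)" and ?b = "b(j := q - p)"
  have im: "?b ` I = b ` I" and "inj_on ?b I"
    using insert.hyps ab(2) by (auto simp: inj_on_def)
  moreover have "q - p \<notin> b ` I"
    using q(2) span_base by metis
  ultimately have "inj_on ?b (insert j I)" "independent (?b ` insert j I)"
    using insert.hyps ab(3) q(2) by (simp_all add: independent_insert)
  moreover have "\<forall>i\<in>insert j I. ?a i \<in> K i \<and> ?a i + ?b i \<in> K i"
    using ab(1) p q(1) by auto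
  ultimately show ?case by blast
qed

text \<open>The periodic continuation of a loop is continuous. Near \<open>x\<close> it is glued
  from shifted copies of \<open>h\<close> on the two unit intervals that meet at the floor of
  \<open>x\<close>, since \<open>x\<close> may be that integer itself.\<close>

lemma continuous_on_frac_comp:
  fixes h :: "real \<Rightarrow> 'a::topological_space"
  assumes "continuous_on {0..1} h" "h 0 = h 1"
  shows "continuous_on UNIV (\<lambda>t. h (frac t))"
proof (rule continuous_at_imp_continuous_on, rule ballI)
  fix x :: real
  define k where "k = real_of_int \<lfloor>x\<rfloor>"
  have frac: "frac t = t - (k - 1)" if "k - 1 \<le> t" "t < k" for t
    using that by (intro frac_unique_iff[THEN iffD2]) (auto simp: k_def)
  have frac': "frac t = t - k" if "k \<le> t" "t < k + 1" for t
    using that by (intro frac_unique_iff[THEN iffD2]) (auto simp: k_def)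
  \<comment> \<open>At the right end of each unit interval \<open>frac\<close> drops to 0 whereas
    the shift gives 1; the assumption \<open>h 0 = h 1\<close> repairs this.\<close>
  have "frac k = 0" "frac (k + 1) = 0"
    unfolding k_def by auto
  then have frac_k: "h (frac k) = h 1" "h (frac (k + 1)) = h 1"
    using assms(2) by metis+
  have "continuous_on {k-1..k} (\<lambda>t. h (frac t)) \<longleftrightarrow> continuous_on {k-1..k} (\<lambda>t. h (t - (k - 1)))"
  proof (intro continuous_on_cong refl)
    fix t assume "t \<in> {k-1..k}"
    then show "h (frac t) = h (t - (k - 1))"
      using frac[of t] frac_k by (cases "t = k") (simp_all del: frac_eq_0_iff)
  qed
  moreover have "continuous_on {k-1..k} (\<lambda>t. h (t - (k - 1)))"
    by (rule continuous_on_compose2[OF assms(1)]) (auto intro!: continuous_intros)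
  moreover have "continuous_on {k..k+1} (\<lambda>t. h (frac t)) \<longleftrightarrow> continuous_on {k..k+1} (\<lambda>t. h (t - k))"
  proof (intro continuous_on_cong refl)
    fix t assume "t \<in> {k..k+1}"
    then show "h (frac t) = h (t - k)"
      using frac'[of t] frac_k by (cases "t = k + 1") (simp_all del: frac_eq_0_iff)
  qed
  moreover have "continuous_on {k..k+1} (\<lambda>t. h (t - k))"
    by (rule continuous_on_compose2[OF assms(1)]) (auto intro!: continuous_intros)
  ultimately have "continuous_on ({k-1..k} \<union> {k..k+1}) (\<lambda>t. h (frac t))"
    by (intro continuous_on_closed_Un) auto
  also have "{k-1..k} \<union> {k..k+1} = {k-1..k+1}"
    by auto
  finally have "continuous_on {k-1..k+1} (\<lambda>t. h (frac t))" .
  moreover have "x \<in> interior {k-1..k+1}"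
    unfolding k_def interior_atLeastAtMost_real by (simp; linarith)
  ultimately show "isCont (\<lambda>t. h (frac t)) x"
    by (rule continuous_on_interior)
qed

lemma linear_vector_combination:
  "linear (\<lambda>v :: real ^ 'n. \<Sum>i\<in>UNIV. (v $ i) *\<^sub>R b i)"
  by (rule linearI) (simp_all add: algebra_simps sum.distrib scaleR_sum_right)

lemma surj_vector_combination:
  fixes b :: "'n::finite \<Rightarrow> real ^ 'n"
  assumes "span (range b) = UNIV"
  shows "surj (\<lambda>v :: real ^ 'n. \<Sum>i\<in>UNIV. (v $ i) *\<^sub>R b i)" (is "surj ?L")
proof -
  have "b i = ?L (axis i 1)" for i
    by (simp add: axis_def if_distrib[of "\<lambda>x. x *\<^sub>R _"] cong: if_cong)
  then have "range b \<subseteq> range ?L"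
    by blast
  moreover have "subspace (range ?L)"
    by (intro linear_subspace_image linear_vector_combination subspace_UNIV)
  ultimately have "span (range b) \<subseteq> range ?L"
    by (rule span_minimal)
  with assms show ?thesis by blast
qed

text \<open>A path from \<open>a\<close> to \<open>a + b\<close>, continued \<open>b\<close>-quasiperiodically, stays at bounded distance from
  the line \<open>t \<mapsto> t *\<^sub>R b\<close>; hence the sum of the continued paths is a bounded continuous perturbation
  of a linear isomorphism, and such maps are onto by Brouwer's fixed point theorem.\<close>

lemma sum_paths_plus_lattice:
  fixes b :: "'n::finite \<Rightarrow> real ^ 'n"
  assumes path: "\<And>i. path (\<gamma> i)" and fin: "\<And>i. pathfinish (\<gamma> i) = pathstart (\<gamma> i) + b i"
    and span: "span (range b) = UNIV"
  shows "\<exists>x m. (\<forall>i. x i \<in> path_image (\<gamma> i)) \<and>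
    y = (\<Sum>i\<in>UNIV. x i) + (\<Sum>i\<in>UNIV. of_int (m i) *\<^sub>R b i)"
proof -
  define L where "L = (\<lambda>v :: real ^ 'n. \<Sum>i\<in>UNIV. (v $ i) *\<^sub>R b i)"
  have "linear L" "surj L"
    unfolding L_def using linear_vector_combination surj_vector_combination[OF span] by auto
  then obtain L' where L': "linear L'" "L \<circ> L' = id"
    using linear_surjective_right_inverse by blast
  \<comment> \<open>The deviation of the path from the line \<open>t *\<^sub>R b i\<close>. It takes
    equal values at 0 and 1, so it continues periodically and stays bounded.\<close>
  define \<delta> where "\<delta> i t = \<gamma> i t - t *\<^sub>R b i" for i t
  have \<delta>: "continuous_on {0..1} (\<delta> i)" "\<delta> i 0 = \<delta> i 1" for i
    using path[of i] fin[of i] unfolding \<delta>_def path_def pathstart_def pathfinish_def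
    by (auto intro!: continuous_intros)
  have "bounded (\<delta> i ` {0..1})" for i
    using \<delta>(1) by (intro compact_imp_bounded compact_continuous_image) auto
  then obtain R where R: "\<And>i t. t \<in> {0..1} \<Longrightarrow> norm (\<delta> i t) \<le> R i"
    unfolding bounded_iff by (metis imageI)
  define \<Psi> where "\<Psi> v = (\<Sum>i\<in>UNIV. \<delta> i (frac (v $ i)))" for v :: "real ^ 'n"
  have bound: "norm (\<Psi> v) \<le> sum R UNIV" for v
    unfolding \<Psi>_def
    by (rule order.trans[OF norm_sum]) (auto intro!: sum_mono R simp: frac_lt_1 less_imp_le)
  have cont\<Psi>: "continuous_on UNIV \<Psi>"
    unfolding \<Psi>_def
  proof (intro continuous_on_sum)
    fix i :: 'n
    show "continuous_on UNIV (\<lambda>v :: real ^ 'n. \<delta> i (frac (v $ i)))"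
      by (rule continuous_on_compose2[OF continuous_on_frac_comp[OF \<delta>]])
        (auto intro!: continuous_intros)
  qed
  \<comment> \<open>A fixed point \<open>z\<close> gives \<open>v = L' z\<close> with
    \<open>L v + \<Psi> v = y\<close>. The added 1 in the radius below keeps the ball
    non-degenerate.\<close>
  define f where "f = (\<lambda>z. y - \<Psi> (L' z))"
  have "continuous_on (cball y (sum R UNIV + 1)) f"
    unfolding f_def using L'(1)
    by (intro continuous_intros continuous_on_compose2[OF cont\<Psi>] linear_continuous_on)
      (auto simp: linear_conv_bounded_linear)
  moreover have "f \<in> cball y (sum R UNIV + 1) \<rightarrow> cball y (sum R UNIV + 1)"
    using order.trans[OF bound, of "sum R UNIV + 1"] by (simp add: f_def dist_norm)
  moreover have "sum R UNIV + 1 > 0"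
    using bound[of 0] norm_ge_zero[of "\<Psi> 0"] by linarith
  ultimately obtain z where z: "f z = z"
    using brouwer_ball by blast
  define v where "v = L' z"
  have "y = L v + \<Psi> v"
    using z L'(2) unfolding f_def v_def by (metis comp_apply diff_add_cancel id_apply)
  also have "\<dots> = (\<Sum>i\<in>UNIV. (v $ i) *\<^sub>R b i + \<delta> i (frac (v $ i)))"
    by (simp add: L_def \<Psi>_def sum.distrib)
  \<comment> \<open>Splitting \<open>v $ i\<close> into fractional and integer part yields a point
    of the path and a lattice vector.\<close>
  also have "\<dots> = (\<Sum>i\<in>UNIV. \<gamma> i (frac (v $ i)) + of_int \<lfloor>v $ i\<rfloor> *\<^sub>R b i)"
    by (intro sum.cong) (auto simp: \<delta>_def frac_def algebra_simps)
  finally have "y = (\<Sum>i\<in>UNIV. \<gamma> i (frac (v $ i))) + (\<Sum>i\<in>UNIV. of_int \<lfloor>v $ i\<rfloor> *\<^sub>R b i)"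
    by (simp add: sum.distrib)
  then show ?thesis
    by (intro exI[of _ "\<lambda>i. \<gamma> i (frac (v $ i))"] exI[of _ "\<lambda>i. \<lfloor>v $ i\<rfloor>"])
      (auto simp: path_image_def frac_lt_1 less_imp_le)
qed

lemma compact_Minkowski_sum:
  fixes K :: "'i \<Rightarrow> 'a::real_normed_vector set"
  assumes "finite I" "\<And>i. i \<in> I \<Longrightarrow> compact (K i)"
  shows "compact {\<Sum>i\<in>I. x i | x. \<forall>i\<in>I. x i \<in> K i}"
  using assms
proof (induction I rule: finite_induct)
  case (insert j I)
  have "{\<Sum>i\<in>insert j I. x i | x. \<forall>i\<in>insert j I. x i \<in> K i}
      = {p + q | p q. p \<in> K j \<and> q \<in> {\<Sum>i\<in>I. x i | x. \<forall>i\<in>I. x i \<in> K i}}" (is "?S = ?T")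
  proof
    show "?S \<subseteq> ?T" using insert.hyps by auto
    show "?T \<subseteq> ?S"
    proof
      fix s assume "s \<in> ?T"
      then obtain p x where px: "s = p + (\<Sum>i\<in>I. x i)" "p \<in> K j" "\<forall>i\<in>I. x i \<in> K i"
        by blast
      have "(\<Sum>i\<in>I. (x(j := p)) i) = (\<Sum>i\<in>I. x i)"
        using insert.hyps by (intro sum.cong) auto
      then show "s \<in> ?S"
        using px insert.hyps by (intro CollectI exI[of _ "x(j := p)"]) auto
    qed
  qed
  moreover have "compact ?T"
    using insert by (intro compact_sums) auto
  ultimately show ?case by simp
qed simp

text \<open>The lattice is the image of the closed set of integer points under an injective linear
  map.\<close>

lemma closed_integer_lattice:
  fixes b :: "'n::finite \<Rightarrow> real ^ 'n"
  assumes "span (range b) = UNIV"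
  shows "closed (range (\<lambda>m. \<Sum>i\<in>UNIV. of_int (m i) *\<^sub>R b i))"
proof -
  let ?L = "\<lambda>v :: real ^ 'n. \<Sum>i\<in>UNIV. (v $ i) *\<^sub>R b i"
  have "closed {v :: real ^ 'n. \<forall>i. v $ i \<in> \<int>}"
    by (intro closed_Collect_all closed_vimage[OF closed_Ints, unfolded vimage_def] continuous_intros)
  moreover have "inj ?L"
    by (intro linear_surjective_imp_injective linear_vector_combination surj_vector_combination assms) simp
  ultimately have "closed (?L ` {v. \<forall>i. v $ i \<in> \<int>})"
    using linear_vector_combination by (intro closed_injective_linear_image)
  moreover have "?L ` {v. \<forall>i. v $ i \<in> \<int>} = range (\<lambda>m. \<Sum>i\<in>UNIV. of_int (m i) *\<^sub>R b i)"
  proof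
    show "?L ` {v. \<forall>i. v $ i \<in> \<int>} \<subseteq> range (\<lambda>m. \<Sum>i\<in>UNIV. of_int (m i) *\<^sub>R b i)"
    proof clarify
      fix v :: "real ^ 'n" assume "\<forall>i. v $ i \<in> \<int>"
      then have "v $ i = of_int \<lfloor>v $ i\<rfloor>" for i by simp
      then have "?L v = (\<Sum>i\<in>UNIV. of_int \<lfloor>v $ i\<rfloor> *\<^sub>R b i)" by metis
      then show "?L v \<in> range (\<lambda>m. \<Sum>i\<in>UNIV. of_int (m i) *\<^sub>R b i)"
        by (intro range_eqI[of _ _ "\<lambda>i. \<lfloor>v $ i\<rfloor>"])
    qed
    show "range (\<lambda>m. \<Sum>i\<in>UNIV. of_int (m i) *\<^sub>R b i) \<subseteq> ?L ` {v. \<forall>i. v $ i \<in> \<int>}"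
    proof clarify
      fix m :: "'n \<Rightarrow> int"
      show "(\<Sum>i\<in>UNIV. of_int (m i) *\<^sub>R b i) \<in> ?L ` {v. \<forall>i. v $ i \<in> \<int>}"
        by (intro image_eqI[of _ _ "\<chi> i. of_int (m i)"]) auto
    qed
  qed
  ultimately show ?thesis by simp
qed

text \<open>Open neighbourhoods of the continua are connected, hence path-connected, so the result
  for paths applies to them and puts \<open>y\<close> into the closure of sumset plus lattice. That
  set is closed, being compact plus closed.\<close>

lemma sum_continua_plus_lattice:
  fixes K :: "'n::finite \<Rightarrow> (real ^ 'n) set"
  assumes K: "\<And>i. compact (K i)" "\<And>i. connected (K i)"
    and ab: "\<And>i. a i \<in> K i" "\<And>i. a i + b i \<in> K i" and span: "span (range b) = UNIV"
  shows "\<exists>x m. (\<forall>i. x i \<in> K i) \<and> y = (\<Sum>i\<in>UNIV. x i) + (\<Sum>i\<in>UNIV. of_int (m i) *\<^sub>R b i)"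
proof -
  define S where "S = {\<Sum>i\<in>UNIV. x i | x. \<forall>i. x i \<in> K i}"
  define \<Lambda> where "\<Lambda> = range (\<lambda>m. \<Sum>i\<in>UNIV. of_int (m i) *\<^sub>R b i)"
  have "compact S"
    using compact_Minkowski_sum[of UNIV K] K(1) by (simp add: S_def)
  moreover have "closed \<Lambda>"
    unfolding \<Lambda>_def using span by (rule closed_integer_lattice)
  ultimately have "closed (\<Union>s\<in>S. \<Union>l\<in>\<Lambda>. {s + l})" (is "closed ?C")
    by (rule compact_closed_sums)
  moreover have "y \<in> closure ?C"
    unfolding closure_approachable
  proof (intro allI impI)
    fix e :: real assume "e > 0"
    \<comment> \<open>One error below \<open>r\<close> arises for each of the \<open>n\<close>
      summands.\<close>
    define r where "r = e / real CARD('n)"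
    have "r > 0" using \<open>e > 0\<close> by (simp add: r_def)
    define N where "N i = (\<Union>x\<in>K i. \<Union>z\<in>ball 0 r. {x + z})" for i
    have KN: "x \<in> N i" if "x \<in> K i" for x i
      using that \<open>r > 0\<close> by (force simp: N_def)
    have "path_connected (N i)" for i
    proof (rule connected_open_path_connected)
      show "open (N i)"
        unfolding N_def by (rule open_sums) simp
      have "connected ((\<lambda>(x,z). x + z) ` (K i \<times> ball 0 r))"
        by (intro connected_continuous_image connected_Times K connected_ball)
          (auto simp: split_beta intro!: continuous_intros)
      also have "(\<lambda>(x,z). x + z) ` (K i \<times> ball 0 r) = N i"
        by (auto simp: N_def)
      finally show "connected (N i)" .
    qed
    then have "\<forall>i. \<exists>\<gamma>. path \<gamma> \<and> path_image \<gamma> \<subseteq> N i \<and> pathstart \<gamma> = a i \<and> pathfinish \<gamma> = a i + b i"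
      unfolding path_connected_def using KN ab by blast
    then obtain \<gamma> where \<gamma>: "\<And>i. path (\<gamma> i)" "\<And>i. path_image (\<gamma> i) \<subseteq> N i"
      "\<And>i. pathstart (\<gamma> i) = a i" "\<And>i. pathfinish (\<gamma> i) = a i + b i" by metis
    obtain u m where um: "\<And>i. u i \<in> path_image (\<gamma> i)"
      "y = (\<Sum>i\<in>UNIV. u i) + (\<Sum>i\<in>UNIV. of_int (m i) *\<^sub>R b i)"
      using sum_paths_plus_lattice[of \<gamma> b y] \<gamma> span by auto
    have "\<forall>i. \<exists>x z. u i = x + z \<and> x \<in> K i \<and> norm z < r"
      using um(1) \<gamma>(2) unfolding N_def by fastforce
    then obtain x z where xz: "\<And>i. u i = x i + z i" "\<And>i. x i \<in> K i" "\<And>i. norm (z i) < r"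
      by metis
    let ?c = "(\<Sum>i\<in>UNIV. x i) + (\<Sum>i\<in>UNIV. of_int (m i) *\<^sub>R b i)"
    have "?c \<in> ?C"
      using xz(2) unfolding S_def \<Lambda>_def by blast
    moreover have "dist ?c y = norm (\<Sum>i\<in>UNIV. z i)"
      by (simp add: um(2) xz(1) sum.distrib dist_norm norm_minus_commute)
    moreover have "norm (\<Sum>i\<in>UNIV. z i) < e"
    proof -
      have "norm (\<Sum>i\<in>UNIV. z i) \<le> (\<Sum>i\<in>UNIV. norm (z i))"
        by (rule norm_sum)
      also have "\<dots> < (\<Sum>i\<in>(UNIV::'n set). r)"
        using xz(3) by (intro sum_strict_mono) auto
      finally show ?thesis by (simp add: r_def)
    qed
    ultimately show "\<exists>c\<in>?C. dist c y < e"
      by (intro bexI[of _ ?c]) simp_all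
  qed
  ultimately have "y \<in> ?C" by simp
  then show ?thesis unfolding S_def \<Lambda>_def by blast
qed

text \<open>Countably many lattice translates of the compact sumset cover the space, so by Baire's
  theorem they cannot all lack interior points.\<close>

theorem interior_sum_continua:
  fixes K :: "'n::finite \<Rightarrow> (real ^ 'n) set"
  assumes K: "\<And>i. compact (K i)" "\<And>i. connected (K i)" and hull: "\<And>i. affine hull (K i) = UNIV"
  shows "interior {\<Sum>i\<in>UNIV. x i | x. \<forall>i. x i \<in> K i} \<noteq> {}"
proof
  let ?S = "{\<Sum>i\<in>UNIV. x i | x. \<forall>i. x i \<in> K i}"
  assume empty: "interior ?S = {}"
  have "compact ?S"
    using compact_Minkowski_sum[of UNIV K] K(1) by simp
  then have "closed ?S" by (rule compact_imp_closed)
  obtain a b where ab: "\<And>i. a i \<in> K i" "\<And>i. a i + b i \<in> K i" "inj b" "independent (range b)"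
    using exists_independent_differences[of K UNIV] hull by (metis UNIV_I)
  have "span (range b) = UNIV"
  proof -
    have "UNIV \<subseteq> span (range b)"
      using ab(3,4) by (intro card_ge_dim_independent) (auto simp: card_image)
    then show ?thesis by blast
  qed
  define l where "l m = (\<Sum>i\<in>UNIV. of_int (m i) *\<^sub>R b i)" for m
  define T where "T m = (+) (l m) ` ?S" for m
  have "UNIV \<subseteq> \<Union>(range T)"
  proof
    fix y
    obtain x m where "\<forall>i. x i \<in> K i" "y = (\<Sum>i\<in>UNIV. x i) + l m"
      using sum_continua_plus_lattice[OF K ab(1,2) \<open>span (range b) = UNIV\<close>] unfolding l_def by blast
    then have "y \<in> T m"
      by (auto simp: T_def add.commute)
    then show "y \<in> \<Union>(range T)" by blast
  qed
  moreover have "closed (T m) \<and> interior (T m) = {}" for m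
    using \<open>closed ?S\<close> empty by (simp add: T_def closed_translation interior_translation)
  \<comment> \<open>The index \<open>m\<close> runs through the integer-valued functions on a finite
    type, a countable set.\<close>
  moreover have "countable (range T)"
    by (intro countable_image countableI_type)
  ultimately have "meager_in euclidean (UNIV :: (real ^ 'n) set)"
    unfolding meager_in_euclidean_iff
    by (intro exI[of _ "range T"]) auto
  then show False
    using meager_open_imp_empty[of "UNIV :: (real ^ 'n) set"] by auto
qed

subsection \<open>Sums of non-meager sets\<close>

text \<open>With finitely many factors, the boxes of basic open sets form a countable base.\<close>

lemma second_countable_product_topology:
  assumes "finite I" "\<And>i. i \<in> I \<Longrightarrow> second_countable (X i)"
  shows "second_countable (product_topology X I)"
proof -
  have "\<exists>\<B>. countable \<B> \<and> (\<forall>V\<in>\<B>. openin (X i) V) \<and>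
      (\<forall>U x. openin (X i) U \<and> x \<in> U \<longrightarrow> (\<exists>V\<in>\<B>. x \<in> V \<and> V \<subseteq> U))" if "i \<in> I" for i
    using assms(2)[OF that] by (simp add: second_countable_def)
  then obtain \<B> where \<B>: "\<And>i. i \<in> I \<Longrightarrow> countable (\<B> i)"
    "\<And>i V. i \<in> I \<Longrightarrow> V \<in> \<B> i \<Longrightarrow> openin (X i) V"
    "\<And>i U x. i \<in> I \<Longrightarrow> openin (X i) U \<Longrightarrow> x \<in> U \<Longrightarrow> \<exists>V\<in>\<B> i. x \<in> V \<and> V \<subseteq> U"
    by metis
  define \<C> where "\<C> = Pi\<^sub>E I ` Pi\<^sub>E I \<B>"
  have "countable \<C>"
    unfolding \<C>_def using assms(1) \<B>(1) by (intro countable_image countable_PiE)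
  moreover have "\<forall>W\<in>\<C>. openin (product_topology X I) W"
    unfolding \<C>_def using assms(1) \<B>(2) by (auto simp: openin_PiE_gen)
  moreover have "\<exists>W\<in>\<C>. x \<in> W \<and> W \<subseteq> U" if U: "openin (product_topology X I) U" "x \<in> U" for U x
  proof -
    obtain Y where Y: "x \<in> Pi\<^sub>E I Y" "\<And>i. openin (X i) (Y i)" "Pi\<^sub>E I Y \<subseteq> U"
      using product_topology_open_contains_basis[OF U] by blast
    then have "\<forall>i\<in>I. \<exists>V\<in>\<B> i. x i \<in> V \<and> V \<subseteq> Y i"
      using \<B>(3) by (meson PiE_mem)
    then obtain V where V: "\<And>i. i \<in> I \<Longrightarrow> V i \<in> \<B> i \<and> x i \<in> V i \<and> V i \<subseteq> Y i"
      by metis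
    have "Pi\<^sub>E I (restrict V I) = Pi\<^sub>E I V"
      by (intro PiE_cong) simp
    then have "Pi\<^sub>E I V \<in> \<C>"
      unfolding \<C>_def using V by (intro image_eqI[of _ _ "restrict V I"]) auto
    moreover have "x \<in> Pi\<^sub>E I V"
      using V Y(1) by (auto simp: PiE_iff)
    moreover have "Pi\<^sub>E I V \<subseteq> U"
      using PiE_mono[of I V Y] V Y(3) by simp
    ultimately show ?thesis by metis
  qed
  ultimately show ?thesis
    unfolding second_countable_def by blast
qed

lemma Polish_space_product_topology:
  assumes "finite I" "\<And>i. i \<in> I \<Longrightarrow> Polish_space (X i)"
  shows "Polish_space (product_topology X I)"
  unfolding Polish_space_def completely_metrizable_space_product_topology
  using assms
  by (auto simp: Polish_space_def second_countable_product_topology intro: countable_finite)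

text \<open>The sets may vary with the index, because the category argument below yields a different
  open set in each coordinate.\<close>

definition weighted_sums :: "('i \<Rightarrow> real) \<Rightarrow> 'i set \<Rightarrow> ('i \<Rightarrow> 'a::real_vector set) \<Rightarrow> 'a set" where
  "weighted_sums w I A = {\<Sum>i\<in>I. w i *\<^sub>R a i | a. \<forall>i\<in>I. a i \<in> A i}"

lemma weighted_sumsI: "(\<And>i. i \<in> I \<Longrightarrow> a i \<in> A i) \<Longrightarrow> (\<Sum>i\<in>I. w i *\<^sub>R a i) \<in> weighted_sums w I A"
  unfolding weighted_sums_def by blast

lemma weighted_sumsE:
  assumes "s \<in> weighted_sums w I A"
  obtains a where "\<And>i. i \<in> I \<Longrightarrow> a i \<in> A i" "s = (\<Sum>i\<in>I. w i *\<^sub>R a i)"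
  using assms unfolding weighted_sums_def by blast

lemma weighted_sums_mono: "A \<subseteq> B \<Longrightarrow> weighted_sums w I (\<lambda>_. A) \<subseteq> weighted_sums w I (\<lambda>_. B)"
  unfolding weighted_sums_def by blast

text \<open>The easy half of the Kuratowski--Ulam theorem: a product of non-meager sets cannot be covered
  by countably many closed sets (here preimages under summation) without open boxes.\<close>

lemma nonmeager_sums_countable_closed_cover:
  fixes K :: "'a::{real_normed_vector, second_countable_topology} set"
  assumes "A \<subseteq> K" and nm: "\<not> meager_in (top_of_set K) A" and "finite I"
    and "countable \<F>" "\<And>F. F \<in> \<F> \<Longrightarrow> closed F" "weighted_sums w I (\<lambda>_. A) \<subseteq> \<Union>\<F>"
  shows "\<exists>F\<in>\<F>. \<exists>U. (\<forall>i\<in>I. openin (top_of_set K) (U i) \<and> U i \<noteq> {}) \<and> weighted_sums w I U \<subseteq> F"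
proof -
  obtain \<V> :: "'a set set" where \<V>: "countable \<V>" "topological_basis \<V>"
    using ex_countable_basis by blast
  \<comment> \<open>Open boxes are restricted to basic ones, so that only countably many compete in
    the induction. The family \<open>\<F>\<close> is generalized since the hypothesis is applied to
    its preimages under translations.\<close>
  have "\<exists>F\<in>\<F>. \<exists>V\<in>Pi\<^sub>E I (\<lambda>_. \<V>). (\<forall>i\<in>I. K \<inter> V i \<noteq> {}) \<and> weighted_sums w I (\<lambda>i. K \<inter> V i) \<subseteq> F"
    using assms(3-6)
  proof (induction I arbitrary: \<F> rule: finite_induct)
    case empty
    then show ?case by (auto simp: weighted_sums_def)
  next
    case (insert j I)
    define \<P> where "\<P> = {V \<in> Pi\<^sub>E I (\<lambda>_. \<V>). \<forall>i\<in>I. K \<inter> V i \<noteq> {}}"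
    \<comment> \<open>The points \<open>a\<close> over which the slice of \<open>F\<close> contains
      the whole box \<open>V\<close>. By induction these countably many sets cover \<open>A\<close>,
      so one is not nowhere dense in \<open>K\<close>.\<close>
    define Q where "Q F V = {a \<in> A. \<forall>s\<in>weighted_sums w I (\<lambda>i. K \<inter> V i). w j *\<^sub>R a + s \<in> F}" for F V
    have "A \<subseteq> (\<Union>(F,V)\<in>\<F>\<times>\<P>. Q F V)"
    proof
      fix a assume "a \<in> A"
      let ?T = "\<lambda>F. (\<lambda>s. w j *\<^sub>R a + s) -` F"
      have "\<exists>F\<in>?T ` \<F>. \<exists>V\<in>Pi\<^sub>E I (\<lambda>_. \<V>). (\<forall>i\<in>I. K \<inter> V i \<noteq> {}) \<and> weighted_sums w I (\<lambda>i. K \<inter> V i) \<subseteq> F"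
      proof (rule insert.IH)
        show "countable (?T ` \<F>)" using insert.prems by simp
        show "closed F" if "F \<in> ?T ` \<F>" for F
          using that insert.prems(2) by (auto intro!: closed_vimage continuous_intros)
        show "weighted_sums w I (\<lambda>_. A) \<subseteq> \<Union>(?T ` \<F>)"
        proof
          fix s assume "s \<in> weighted_sums w I (\<lambda>_. A)"
          then obtain b where b: "\<And>i. i \<in> I \<Longrightarrow> b i \<in> A" "s = (\<Sum>i\<in>I. w i *\<^sub>R b i)"
            by (rule weighted_sumsE) blast
          have "(\<Sum>i\<in>insert j I. w i *\<^sub>R (b(j := a)) i) \<in> weighted_sums w (insert j I) (\<lambda>_. A)"
            using b(1) \<open>a \<in> A\<close> by (intro weighted_sumsI) auto
          moreover have "(\<Sum>i\<in>I. w i *\<^sub>R (b(j := a)) i) = s"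
            unfolding b(2) using insert.hyps by (intro sum.cong) auto
          ultimately have "w j *\<^sub>R a + s \<in> \<Union>\<F>"
            using insert.prems(3) insert.hyps by auto
          then show "s \<in> \<Union>(?T ` \<F>)" by auto
        qed
      qed
      then obtain F V where "F \<in> \<F>" "V \<in> \<P>" "weighted_sums w I (\<lambda>i. K \<inter> V i) \<subseteq> ?T F"
        unfolding \<P>_def by blast
      then have "a \<in> Q F V"
        using \<open>a \<in> A\<close> unfolding Q_def by blast
      with \<open>F \<in> \<F>\<close> \<open>V \<in> \<P>\<close> show "a \<in> (\<Union>(F,V)\<in>\<F>\<times>\<P>. Q F V)" by blast
    qed
    moreover have "Q F V \<subseteq> A" for F V
      unfolding Q_def by blast
    ultimately have "A = \<Union>((\<lambda>(F,V). Q F V) ` (\<F> \<times> \<P>))"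
      by fastforce
    moreover have "countable ((\<lambda>(F,V). Q F V) ` (\<F> \<times> \<P>))"
    proof -
      have "countable (Pi\<^sub>E I (\<lambda>_. \<V>))"
        using insert.hyps \<V>(1) by (intro countable_PiE)
      then have "countable \<P>"
        unfolding \<P>_def by simp
      then show ?thesis using insert.prems(1) by blast
    qed
    ultimately obtain F V where FV: "F \<in> \<F>" "V \<in> \<P>" "\<not> nowhere_dense_in (top_of_set K) (Q F V)"
      using nm unfolding meager_in_def by fastforce
    have QK: "Q F V \<subseteq> K"
      using \<open>A \<subseteq> K\<close> unfolding Q_def by blast
    define W where "W = top_of_set K interior_of (top_of_set K closure_of Q F V)"
    have W: "openin (top_of_set K) W" "W \<noteq> {}" "W \<subseteq> closure (Q F V)"
    proof -
      show "W \<noteq> {}"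
        using FV(3) QK unfolding nowhere_dense_in_def W_def by simp
      show "W \<subseteq> closure (Q F V)"
        using interior_of_subset[of "top_of_set K" "top_of_set K closure_of Q F V"] QK
          closure_of_subtopology_subset[of euclidean K "Q F V"]
        unfolding W_def by auto
    qed (simp add: W_def)
    then obtain x O' where O': "open O'" "W = K \<inter> O'" "x \<in> W"
      by (auto simp: openin_open)
    then obtain B where B: "B \<in> \<V>" "x \<in> B" "B \<subseteq> O'"
      using topological_basisE[OF \<V>(2) O'(1)] by blast
    let ?V = "V(j := B)"
    have V: "V \<in> Pi\<^sub>E I (\<lambda>_. \<V>)" "\<And>i. i \<in> I \<Longrightarrow> K \<inter> V i \<noteq> {}"
      using FV(2) unfolding \<P>_def by auto
    then have "?V \<in> Pi\<^sub>E (insert j I) (\<lambda>_. \<V>)"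
      using B(1) by (rule_tac PiE_fun_upd) auto
    moreover have "\<forall>i\<in>insert j I. K \<inter> ?V i \<noteq> {}"
      using V(2) B(2) O'(2,3) by auto
    moreover have "weighted_sums w (insert j I) (\<lambda>i. K \<inter> ?V i) \<subseteq> F"
    proof
      fix s assume "s \<in> weighted_sums w (insert j I) (\<lambda>i. K \<inter> ?V i)"
      then obtain u where u: "\<And>i. i \<in> insert j I \<Longrightarrow> u i \<in> K \<inter> ?V i"
        "s = (\<Sum>i\<in>insert j I. w i *\<^sub>R u i)"
        by (rule weighted_sumsE) blast
      define t where "t = (\<Sum>i\<in>I. w i *\<^sub>R u i)"
      have s: "s = w j *\<^sub>R u j + t"
        using u(2) insert.hyps by (simp add: t_def)
      have "u i \<in> K \<inter> V i" if "i \<in> I" for i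
        using u(1)[of i] that insert.hyps by (cases "i = j") auto
      then have "t \<in> weighted_sums w I (\<lambda>i. K \<inter> V i)"
        unfolding t_def by (rule weighted_sumsI)
      \<comment> \<open>For fixed \<open>t\<close>, membership in \<open>F\<close> is a closed
        condition on the \<open>j\<close>-th summand, so it passes from \<open>Q F V\<close> to its
        closure and thus to \<open>W\<close>.\<close>
      then have "Q F V \<subseteq> (\<lambda>a. w j *\<^sub>R a + t) -` F"
        unfolding Q_def by blast
      moreover have "closed ((\<lambda>a. w j *\<^sub>R a + t) -` F)"
        using insert.prems(2) FV(1) by (intro closed_vimage continuous_intros) auto
      ultimately have "closure (Q F V) \<subseteq> (\<lambda>a. w j *\<^sub>R a + t) -` F"
        by (rule closure_minimal)
      moreover have "u j \<in> W"
        using u(1)[of j] B(3) O'(2) by auto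
      ultimately show "s \<in> F"
        using W(3) s by blast
    qed
    ultimately show ?case
      using FV(1) by blast
  qed
  then obtain F V where FV: "F \<in> \<F>" "V \<in> Pi\<^sub>E I (\<lambda>_. \<V>)" "\<forall>i\<in>I. K \<inter> V i \<noteq> {}"
    "weighted_sums w I (\<lambda>i. K \<inter> V i) \<subseteq> F" by blast
  have "openin (top_of_set K) (K \<inter> V i)" if "i \<in> I" for i
    using FV(2) \<V>(2) that by (auto simp: PiE_iff intro!: openin_open_Int topological_basis_open)
  with FV show ?thesis
    by (intro bexI[of _ F] exI[of _ "\<lambda>i. K \<inter> V i"]) auto
qed

lemma weighted_sums_closure:
  fixes U :: "'i \<Rightarrow> 'a::real_normed_vector set"
  shows "weighted_sums w I (\<lambda>i. closure (U i)) \<subseteq> closure (weighted_sums w I U)"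
proof
  fix s assume "s \<in> weighted_sums w I (\<lambda>i. closure (U i))"
  then obtain x where x: "\<And>i. i \<in> I \<Longrightarrow> x i \<in> closure (U i)" "s = (\<Sum>i\<in>I. w i *\<^sub>R x i)"
    by (rule weighted_sumsE) blast
  have "\<forall>i\<in>I. \<exists>\<xi>. (\<forall>n. \<xi> n \<in> U i) \<and> \<xi> \<longlonglongrightarrow> x i"
    using x(1) by (simp add: closure_sequential)
  then obtain \<xi> where \<xi>: "\<And>i n. i \<in> I \<Longrightarrow> \<xi> i n \<in> U i" "\<And>i. i \<in> I \<Longrightarrow> \<xi> i \<longlonglongrightarrow> x i"
    by metis
  have "(\<lambda>n. \<Sum>i\<in>I. w i *\<^sub>R \<xi> i n) \<longlonglongrightarrow> s"
    unfolding x(2) using \<xi>(2) by (intro tendsto_intros)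
  moreover have "(\<Sum>i\<in>I. w i *\<^sub>R \<xi> i n) \<in> weighted_sums w I U" for n
    using \<xi>(1) by (intro weighted_sumsI)
  ultimately show "s \<in> closure (weighted_sums w I U)"
    unfolding closure_sequential by (intro exI[of _ "\<lambda>n. \<Sum>i\<in>I. w i *\<^sub>R \<xi> i n"]) blast
qed

text \<open>Scaling by a non-zero weight keeps a set compact, connected and affinely spanning, which
  reduces the claim to plain sums.\<close>

lemma interior_weighted_sums_continua:
  fixes K :: "'n::finite \<Rightarrow> (real ^ 'n) set"
  assumes "\<And>i. compact (K i)" "\<And>i. connected (K i)" "\<And>i. affine hull (K i) = UNIV" "\<And>i. w i \<noteq> 0"
  shows "interior (weighted_sums w UNIV K) \<noteq> {}"
proof -
  let ?K = "\<lambda>i. (*\<^sub>R) (w i) ` K i"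
  have lin: "bounded_linear ((*\<^sub>R) c :: real ^ 'n \<Rightarrow> real ^ 'n)" for c
    by (rule bounded_linear_scaleR_right)
  have "(*\<^sub>R) (w i) ` (UNIV :: (real ^ 'n) set) = UNIV" for i
    using assms(4)[of i] by (intro surjI[of _ "(*\<^sub>R) (1 / w i)"]) simp
  then have "affine hull (?K i) = UNIV" for i
    using affine_hull_linear_image[OF lin, of "w i" "K i"] assms(3)[of i] by simp
  then have "interior {\<Sum>i\<in>UNIV. x i | x. \<forall>i. x i \<in> ?K i} \<noteq> {}"
    using assms(1,2)
    by (intro interior_sum_continua compact_continuous_image connected_continuous_image
        continuous_intros) auto
  moreover have "{\<Sum>i\<in>UNIV. x i | x. \<forall>i. x i \<in> ?K i} = weighted_sums w UNIV K"
  proof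
    show "weighted_sums w UNIV K \<subseteq> {\<Sum>i\<in>UNIV. x i | x. \<forall>i. x i \<in> ?K i}"
      unfolding weighted_sums_def by blast
    show "{\<Sum>i\<in>UNIV. x i | x. \<forall>i. x i \<in> ?K i} \<subseteq> weighted_sums w UNIV K"
    proof clarify
      fix x assume "\<forall>i. x i \<in> ?K i"
      then obtain k where "\<And>i. k i \<in> K i" "\<And>i. x i = w i *\<^sub>R k i"
        unfolding image_iff by metis
      then show "sum x UNIV \<in> weighted_sums w UNIV K"
        by (simp add: weighted_sumsI)
    qed
  qed
  ultimately show ?thesis by simp
qed

text \<open>If closed sets without interior covered the sums, one of them would contain the sums of
  relatively open pieces of \<open>K\<close>. Local connectedness makes the pieces connected,
  nowhere flatness makes them spanning, and their closures are continua whose sums have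
  interior.\<close>

theorem nonmeager_weighted_sums:
  fixes K :: "(real ^ 'n::finite) set"
  assumes "nowhere_flat K" "locally connected K" "A \<subseteq> K" "\<not> meager_in (top_of_set K) A"
    and w: "\<And>i. w i \<noteq> 0"
  shows "\<not> meager_in euclidean (weighted_sums w (UNIV :: 'n set) (\<lambda>_. A))"
proof
  assume "meager_in euclidean (weighted_sums w (UNIV :: 'n set) (\<lambda>_. A))"
  then obtain \<F> where \<F>: "countable \<F>" "\<And>F. F \<in> \<F> \<Longrightarrow> closed F \<and> interior F = {}"
    "weighted_sums w (UNIV :: 'n set) (\<lambda>_. A) \<subseteq> \<Union>\<F>"
    unfolding meager_in_euclidean_iff by blast
  obtain F U where F: "F \<in> \<F>" and
    U: "\<forall>i\<in>(UNIV :: 'n set). openin (top_of_set K) (U i) \<and> U i \<noteq> {}" "weighted_sums w UNIV U \<subseteq> F"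
    using nonmeager_sums_countable_closed_cover[OF assms(3,4) finite \<F>(1) _ \<F>(3)] \<F>(2) by blast
  have "\<exists>C. openin (top_of_set K) C \<and> connected C \<and> C \<noteq> {} \<and> bounded C \<and> C \<subseteq> U i" for i
  proof -
    obtain x where x: "x \<in> U i" using U(1) by blast
    \<comment> \<open>The ball only serves to make the piece bounded and its closure
      compact.\<close>
    have "openin (top_of_set K) (U i \<inter> ball x 1)"
      using U(1) by (simp add: openin_Int_open)
    then obtain C where "openin (top_of_set K) C" "connected C" "x \<in> C" "C \<subseteq> U i \<inter> ball x 1"
      using assms(2) x unfolding locally_connected by (metis IntI centre_in_ball zero_less_one)
    then show ?thesis
      using bounded_subset[OF bounded_ball, of C x 1] by blast
  qed
  then obtain C where C: "\<And>i. openin (top_of_set K) (C i)" "\<And>i. connected (C i)"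
    "\<And>i. C i \<noteq> {}" "\<And>i. bounded (C i)" "\<And>i. C i \<subseteq> U i"
    by metis
  have "affine hull (closure (C i)) = UNIV" for i
  proof -
    have "affine hull (C i) = UNIV"
      using assms(1) C(1,3) not_flat_iff unfolding nowhere_flat_def by metis
    then show ?thesis
      using hull_mono[OF closure_subset, of affine "C i"] by simp
  qed
  then have "interior (weighted_sums w UNIV (\<lambda>i. closure (C i))) \<noteq> {}"
    using C(2,4) w by (intro interior_weighted_sums_continua connected_imp_connected_closure) auto
  moreover have "weighted_sums w UNIV C \<subseteq> weighted_sums w UNIV U"
    using C(5) unfolding weighted_sums_def by blast
  then have "closure (weighted_sums w UNIV C) \<subseteq> F"
    using U(2) \<F>(2)[OF F] by (intro closure_minimal) auto
  then have "weighted_sums w UNIV (\<lambda>i. closure (C i)) \<subseteq> F"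
    using weighted_sums_closure by blast
  then have "interior (weighted_sums w UNIV (\<lambda>i. closure (C i))) \<subseteq> interior F"
    by (rule interior_mono)
  ultimately show False
    using \<F>(2)[OF F] by simp
qed

text \<open>The weighted sums are a continuous image of a finite power of the Polish space that
  parametrizes \<open>A\<close>; being non-meager, they are comeager in some non-empty open
  set.\<close>

lemma weighted_sums_analytic_midpoints:
  fixes A :: "'a::euclidean_space set"
  assumes "analytic_set A" "finite I"
    and nm: "\<not> meager_in euclidean (weighted_sums w I (\<lambda>_. A))"
  obtains V where "open V" "V \<noteq> {}"
    "\<And>x. x \<in> V \<Longrightarrow> \<exists>y\<in>weighted_sums w I (\<lambda>_. A). \<exists>z\<in>weighted_sums w I (\<lambda>_. A). x = midpoint y z"
proof -
  let ?S = "weighted_sums w I (\<lambda>_. A)"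
  obtain X :: "real topology" and g where X: "Polish_space X" "continuous_map X euclidean g"
    "g ` topspace X = A"
    using assms(1) unfolding analytic_set_def by blast
  define Y where "Y = product_topology (\<lambda>_. X) I"
  define h where "h p = (\<Sum>i\<in>I. w i *\<^sub>R g (p i))" for p
  have "Polish_space Y"
    unfolding Y_def using assms(2) X(1) by (intro Polish_space_product_topology)
  moreover have "continuous_map Y euclidean (\<lambda>p. w i *\<^sub>R g (p i))" if "i \<in> I" for i
  proof -
    have "continuous_map Y X (\<lambda>p. p i)"
      unfolding Y_def using that by (rule continuous_map_product_projection)
    then have "continuous_map Y euclidean (g \<circ> (\<lambda>p. p i))"
      using X(2) by (rule continuous_map_compose)
    moreover have "continuous_map euclidean euclidean ((*\<^sub>R) (w i) :: 'a \<Rightarrow> 'a)"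
      by (auto intro!: continuous_intros)
    ultimately have "continuous_map Y euclidean ((*\<^sub>R) (w i) \<circ> (g \<circ> (\<lambda>p. p i)))"
      by (rule continuous_map_compose)
    then show ?thesis by (simp add: comp_def)
  qed
  then have "continuous_map Y euclidean h"
    unfolding h_def using assms(2) by (intro continuous_map_sum)
  moreover have "h ` topspace Y = ?S"
  proof
    show "h ` topspace Y \<subseteq> ?S"
      unfolding h_def Y_def using X(3) by (auto intro!: weighted_sumsI)
    show "?S \<subseteq> h ` topspace Y"
    proof
      fix s assume "s \<in> ?S"
      then obtain a where a: "\<And>i. i \<in> I \<Longrightarrow> a i \<in> A" "s = (\<Sum>i\<in>I. w i *\<^sub>R a i)"
        by (rule weighted_sumsE) blast
      have "\<forall>i\<in>I. \<exists>p\<in>topspace X. g p = a i"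
        using a(1) X(3) by (metis imageE)
      then obtain p where "\<And>i. i \<in> I \<Longrightarrow> p i \<in> topspace X \<and> g (p i) = a i"
        by metis
      \<comment> \<open>Points of the product are extensional functions, hence the restriction of
        \<open>p\<close> to \<open>I\<close>.\<close>
      then show "s \<in> h ` topspace Y"
        by (intro image_eqI[of _ _ "restrict p I"]) (auto simp: h_def Y_def a(2))
    qed
  qed
  ultimately obtain V where "open V" "V \<noteq> {}" "meager_in euclidean (V - ?S)"
    using Polish_image_comeager_in_open[of Y h] nm by auto
  then show ?thesis
    using that comeager_in_open_subset_midpoints by metis
qed

subsection \<open>Mid-convex functions\<close>

text \<open>Repeated halving towards \<open>x\<close>: each point is the midpoint of
  \<open>x\<close> and its predecessor.\<close>

lemma mid_convex_on_dyadic: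
  assumes "convex D" "mid_convex_on D f" "x \<in> D" "z \<in> D"
  shows "f (x + (1 / 2 ^ p) *\<^sub>R (z - x)) \<le> f x + (f z - f x) / 2 ^ p"
proof (induction p)
  case 0
  show ?case by simp
next
  case (Suc p)
  let ?y = "x + (1 / 2 ^ p) *\<^sub>R (z - x)"
  have "?y = (1 - 1 / 2 ^ p) *\<^sub>R x + (1 / 2 ^ p) *\<^sub>R z"
    by (simp add: algebra_simps)
  also have "\<dots> \<in> D"
    using assms by (intro convexD) auto
  finally have "f (midpoint x ?y) \<le> (f x + f ?y) / 2"
    using assms(2,3) unfolding mid_convex_on_def by blast
  also have "\<dots> \<le> f x + (f z - f x) / 2 ^ Suc p"
    using Suc by (simp add: field_simps)
  also have "midpoint x ?y = x + (1 / 2 ^ Suc p) *\<^sub>R (z - x)"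
  proof -
    have "midpoint x ?y = (1 / 2) *\<^sub>R (x + x) + (1 / 2) *\<^sub>R (1 / 2 ^ p) *\<^sub>R (z - x)"
      by (simp add: midpoint_def algebra_simps)
    also have "(1 / 2) *\<^sub>R (x + x) = x"
      by (simp flip: scaleR_2)
    finally show ?thesis by simp
  qed
  finally show ?case .
qed

text \<open>Prolong the segment from \<open>v\<close> to \<open>y\<close> slightly beyond
  \<open>y\<close> to a point \<open>z\<close> of \<open>D\<close>. The contraction with centre
  \<open>z\<close> and dyadic ratio \<open>1 / q\<close> carries a ball about \<open>v\<close> onto
  one about \<open>y\<close>, and the bound with it.\<close>

lemma mid_convex_on_locally_bounded_above:
  fixes D :: "'a::real_normed_vector set"
  assumes "open D" "convex D" "mid_convex_on D f"
    and V: "open V" "V \<noteq> {}" "V \<subseteq> D" "\<And>v. v \<in> V \<Longrightarrow> f v \<le> M" and "y \<in> D"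
  obtains r B where "r > 0" "ball y r \<subseteq> D" "\<And>x. x \<in> ball y r \<Longrightarrow> f x \<le> B"
proof -
  obtain v \<rho> where v: "\<rho> > 0" "ball v \<rho> \<subseteq> V"
    using V(1,2) open_contains_ball by blast
  obtain e where e: "e > 0" "ball y e \<subseteq> D"
    using assms(1) \<open>y \<in> D\<close> open_contains_ball by blast
  have "0 < e / (norm (y - v) + 1)"
    using e(1) by (simp add: add_nonneg_pos)
  then obtain p where p: "(1/2::real) ^ p < e / (norm (y - v) + 1)"
    using real_arch_pow_inv[of _ "1/2"] by auto
  \<comment> \<open>The exponent \<open>Suc p\<close> leaves \<open>q - 1\<close> at least
    \<open>2 ^ p\<close>, so that \<open>z\<close>, at distance
    \<open>norm (y - v) / (q - 1)\<close> from \<open>y\<close>, stays within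
    \<open>e\<close>.\<close>
  define q :: real where "q = 2 ^ Suc p"
  have "(1::real) \<le> 2 ^ p" by simp
  then have q: "q \<ge> 2" "q - 1 \<ge> 2 ^ p"
    unfolding q_def by auto
  define z where "z = y + (1 / (q - 1)) *\<^sub>R (y - v)"
  have "z \<in> ball y e"
  proof -
    have "dist y z = norm (y - v) / (q - 1)"
      using q by (simp add: z_def dist_norm)
    also have "\<dots> \<le> norm (y - v) / 2 ^ p"
      using q by (intro divide_left_mono) auto
    also have "\<dots> \<le> (norm (y - v) + 1) * (1/2) ^ p"
      by (simp add: power_one_over field_simps)
    also have "\<dots> < e"
      using p by (simp add: pos_less_divide_eq add_nonneg_pos mult.commute)
    finally show ?thesis by simp
  qed
  then have "z \<in> D" using e(2) by blast
  have y: "y = z + (1 / q) *\<^sub>R (v - z)"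
  proof -
    have "v - z = - (1 + 1 / (q - 1)) *\<^sub>R (y - v)"
      by (simp add: z_def algebra_simps)
    also have "1 + 1 / (q - 1) = q / (q - 1)"
      using q by (simp add: field_simps)
    finally show ?thesis
      using q by (simp add: z_def)
  qed
  have main: "x \<in> D \<and> f x \<le> f z + (M - f z) / q" if "x \<in> ball y (\<rho> / q)" for x
  proof -
    \<comment> \<open>The preimage of \<open>x\<close> under the contraction.\<close>
    define u where "u = v + q *\<^sub>R (x - y)"
    have "dist v u = q * dist y x"
      using q by (simp add: u_def dist_norm norm_minus_commute)
    also have "\<dots> < \<rho>"
      using that q by (simp add: field_simps)
    finally have u: "u \<in> D" "f u \<le> M"
      using v(2) V(3,4) by auto
    have "z + (1 / q) *\<^sub>R (u - z) = z + (1 / q) *\<^sub>R (v - z) + (x - y)"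
      using q by (simp add: u_def algebra_simps)
    then have x: "x = z + (1 / q) *\<^sub>R (u - z)"
      using y by simp
    also have "\<dots> = (1 - 1 / q) *\<^sub>R z + (1 / q) *\<^sub>R u"
      by (simp add: algebra_simps)
    also have "\<dots> \<in> D"
      using assms(2) \<open>z \<in> D\<close> u(1) q by (intro convexD) auto
    finally have "x \<in> D" .
    moreover have "f x \<le> f z + (f u - f z) / q"
      using mid_convex_on_dyadic[OF assms(2,3) \<open>z \<in> D\<close> u(1), of "Suc p"] x unfolding q_def by simp
    moreover have "(f u - f z) / q \<le> (M - f z) / q"
      using u(2) q by (intro divide_right_mono) auto
    ultimately show ?thesis by simp
  qed
  show ?thesis
  proof (rule that[of "\<rho> / q" "f z + (M - f z) / q"])
    show "\<rho> / q > 0" using v(1) q by simp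
  qed (use main in auto)
qed

text \<open>Near \<open>x\<close> the function is bounded above by some \<open>B\<close>.
  Contracting towards \<open>x\<close> by \<open>2 ^ p\<close> shrinks the possible excess over
  \<open>f x\<close> to \<open>(B - f x) / 2 ^ p\<close>, and reflection in \<open>x\<close> turns
  this upper estimate into a lower one.\<close>

theorem Bernstein_Doetsch:
  fixes D :: "'a::real_normed_vector set"
  assumes D: "open D" "convex D" and f: "mid_convex_on D f"
    and V: "open V" "V \<noteq> {}" "V \<subseteq> D" "bdd_above (f ` V)"
  shows "continuous_on D f"
  unfolding continuous_on_iff
proof (intro ballI allI impI)
  fix x and \<epsilon> :: real assume "x \<in> D" "\<epsilon> > 0"
  obtain M where "\<And>v. v \<in> V \<Longrightarrow> f v \<le> M"
    using V(4) unfolding bdd_above_def by blast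
  then obtain r B where r: "r > 0" "ball x r \<subseteq> D" "\<And>u. u \<in> ball x r \<Longrightarrow> f u \<le> B"
    using mid_convex_on_locally_bounded_above[OF D f V(1-3) _ \<open>x \<in> D\<close>] by metis
  have "f x \<le> B" using r by simp
  \<comment> \<open>Adding 1 keeps the denominator positive when \<open>B = f x\<close>.\<close>
  then have "0 < \<epsilon> / (B - f x + 1)"
    using \<open>\<epsilon> > 0\<close> by simp
  then obtain p where p: "(1/2::real) ^ p < \<epsilon> / (B - f x + 1)"
    using real_arch_pow_inv[of _ "1/2"] by auto
  have small: "(B - f x) / 2 ^ p < \<epsilon>"
  proof -
    have "(B - f x) / 2 ^ p \<le> (B - f x + 1) * (1/2) ^ p"
      by (simp add: power_one_over field_simps)
    also have "\<dots> < \<epsilon>"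
      using p \<open>f x \<le> B\<close> by (simp add: pos_less_divide_eq mult.commute)
    finally show ?thesis .
  qed
  have upper: "x + h \<in> D \<and> f (x + h) \<le> f x + (B - f x) / 2 ^ p" if "norm h < r / 2 ^ p" for h
  proof -
    let ?u = "x + 2 ^ p *\<^sub>R h"
    have "?u \<in> ball x r"
      using that by (simp add: dist_norm field_simps)
    then have u: "?u \<in> D" "f ?u \<le> B"
      using r by auto
    have "f (x + h) \<le> f x + (f ?u - f x) / 2 ^ p"
      using mid_convex_on_dyadic[OF D(2) f \<open>x \<in> D\<close> u(1), of p] by simp
    also have "\<dots> \<le> f x + (B - f x) / 2 ^ p"
      using u(2) by (simp add: divide_right_mono)
    finally have "f (x + h) \<le> f x + (B - f x) / 2 ^ p" .
    moreover have "r / 2 ^ p \<le> r"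
      using r(1) by (simp add: field_simps)
    then have "x + h \<in> D"
      using that r(2) by (auto simp: subset_iff dist_norm)
    ultimately show ?thesis by simp
  qed
  show "\<exists>\<delta>>0. \<forall>x'\<in>D. dist x' x < \<delta> \<longrightarrow> dist (f x') (f x) < \<epsilon>"
  proof (intro exI[of _ "r / 2 ^ p"] conjI ballI impI)
    show "r / 2 ^ p > 0" using r(1) by simp
    fix x' assume "x' \<in> D" "dist x' x < r / 2 ^ p"
    then have h: "norm (x' - x) < r / 2 ^ p" "norm (x - x') < r / 2 ^ p"
      by (simp_all add: dist_norm norm_minus_commute)
    have "f x' \<le> f x + (B - f x) / 2 ^ p"
      using upper[OF h(1)] by simp
    moreover have "2 * f x - f x' \<le> f (x + (x - x'))"
    proof -
      have "midpoint x' (x + (x - x')) = x"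
        by (simp add: midpoint_def flip: scaleR_2)
      then show ?thesis
        using f \<open>x' \<in> D\<close> upper[OF h(2)] unfolding mid_convex_on_def by fastforce
    qed
    moreover have "f (x + (x - x')) \<le> f x + (B - f x) / 2 ^ p"
      using upper[OF h(2)] by simp
    ultimately show "dist (f x') (f x) < \<epsilon>"
      using small unfolding dist_real_def by linarith
  qed
qed

section \<open>Midpoint-closed sets\<close>

text \<open>Taking the midpoint of a new point and an old combination halves \<open>c\<close> and
  the old weights and gives the new point the weight 1/2.\<close>

lemma midpoint_closed_weighted_sums:
  assumes "finite I" "c\<^sub>0 \<in> T" and mid: "\<And>x y. x \<in> T \<Longrightarrow> y \<in> T \<Longrightarrow> midpoint x y \<in> T"
  shows "\<exists>c w. (\<forall>i. w i > 0) \<and> (+) c ` weighted_sums w I (\<lambda>_. T) \<subseteq> T"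
  using assms(1)
proof (induction I rule: finite_induct)
  case empty
  show ?case
    using assms(2) by (intro exI[of _ c\<^sub>0] exI[of _ "\<lambda>_. 1"]) (auto simp: weighted_sums_def)
next
  case (insert j I)
  then obtain c w where w: "\<And>i. w i > 0" and sub: "(+) c ` weighted_sums w I (\<lambda>_. T) \<subseteq> T"
    by blast
  let ?w = "(\<lambda>i. w i / 2)(j := 1 / 2)"
  have "(1 / 2) *\<^sub>R c + s \<in> T" if s: "s \<in> weighted_sums ?w (insert j I) (\<lambda>_. T)" for s
  proof -
    obtain x where x: "\<And>i. i \<in> insert j I \<Longrightarrow> x i \<in> T" "s = (\<Sum>i\<in>insert j I. ?w i *\<^sub>R x i)"
      using s by (rule weighted_sumsE) blast
    have "(\<Sum>i\<in>I. w i *\<^sub>R x i) \<in> weighted_sums w I (\<lambda>_. T)"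
      using x(1) by (intro weighted_sumsI) auto
    then have "midpoint (x j) (c + (\<Sum>i\<in>I. w i *\<^sub>R x i)) \<in> T"
      using sub x(1) by (intro mid) auto
    moreover have "(\<Sum>i\<in>I. ?w i *\<^sub>R x i) = (1 / 2) *\<^sub>R (\<Sum>i\<in>I. w i *\<^sub>R x i)"
      unfolding scaleR_sum_right using insert.hyps by (intro sum.cong) auto
    then have "(1 / 2) *\<^sub>R c + s = midpoint (x j) (c + (\<Sum>i\<in>I. w i *\<^sub>R x i))"
      using insert.hyps by (simp add: x(2) midpoint_def algebra_simps)
    ultimately show ?thesis by simp
  qed
  moreover have "\<forall>i. ?w i > 0" using w by simp
  ultimately show ?case by blast
qed

text \<open>The result on sums of continua is applied with the same \<open>K\<close> in every
  coordinate.\<close>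

lemma interior_midpoint_closed_continuum:
  fixes T :: "(real ^ 'n::finite) set"
  assumes mid: "\<And>x y. x \<in> T \<Longrightarrow> y \<in> T \<Longrightarrow> midpoint x y \<in> T"
    and K: "K \<subseteq> T" "continuum K" "\<not> flat K"
  shows "interior T \<noteq> {}"
proof -
  have hull: "affine hull K = UNIV"
    using K(3) not_flat_iff by blast
  obtain k where "k \<in> T"
    using K(1,2) unfolding continuum_def by blast
  then obtain c and w :: "'n \<Rightarrow> real" where w: "\<And>i. w i > 0"
    and sub: "(+) c ` weighted_sums w UNIV (\<lambda>_. T) \<subseteq> T"
    using midpoint_closed_weighted_sums[of "UNIV :: 'n set", OF finite _ mid] by blast
  have "interior (weighted_sums w UNIV (\<lambda>_. K)) \<noteq> {}"
    using K(2) hull less_imp_neq[OF w]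
    by (intro interior_weighted_sums_continua) (auto simp: continuum_def)
  then have "interior ((+) c ` weighted_sums w UNIV (\<lambda>_. K)) \<noteq> {}"
    by (simp add: interior_translation)
  moreover have "(+) c ` weighted_sums w UNIV (\<lambda>_. K) \<subseteq> T"
    using weighted_sums_mono[OF K(1), of w UNIV] sub by blast
  ultimately show ?thesis
    using interior_mono by blast
qed

text \<open>The weighted sums of \<open>A\<close> need not have interior points, but their midpoints
  fill an open set, and one more midpoint keeps the translates by \<open>c\<close> inside
  \<open>T\<close>.\<close>

lemma interior_midpoint_closed_analytic:
  fixes T :: "(real ^ 'n::finite) set"
  assumes mid: "\<And>x y. x \<in> T \<Longrightarrow> y \<in> T \<Longrightarrow> midpoint x y \<in> T"
    and K: "nowhere_flat K" "locally connected K"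
    and A: "A \<subseteq> K" "A \<subseteq> T" "analytic_set A" "\<not> meager_in (top_of_set K) A"
  shows "interior T \<noteq> {}"
proof -
  have "A \<noteq> {}"
    using A(4) unfolding meager_in_def by (metis Union_empty countable_empty empty_iff)
  then obtain a where "a \<in> T" using A(2) by blast
  then obtain c and w :: "'n \<Rightarrow> real" where w: "\<And>i. w i > 0"
    and sub: "(+) c ` weighted_sums w UNIV (\<lambda>_. T) \<subseteq> T"
    using midpoint_closed_weighted_sums[of "UNIV :: 'n set", OF finite _ mid] by blast
  let ?S = "weighted_sums w (UNIV :: 'n set) (\<lambda>_. A)"
  have "w i \<noteq> 0" for i
    using w[of i] by simp
  then have "\<not> meager_in euclidean ?S"
    using K A(1,4) by (intro nonmeager_weighted_sums)
  then obtain V where V: "open V" "V \<noteq> {}" "\<And>x. x \<in> V \<Longrightarrow> \<exists>y\<in>?S. \<exists>z\<in>?S. x = midpoint y z"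
    using weighted_sums_analytic_midpoints[OF A(3) finite] by metis
  have "(+) c ` V \<subseteq> T"
  proof clarify
    fix x assume "x \<in> V"
    then obtain y z where yz: "y \<in> ?S" "z \<in> ?S" "x = midpoint y z"
      using V(3) by blast
    then have "midpoint (c + y) (c + z) \<in> T"
      using sub weighted_sums_mono[OF A(2), of w UNIV] by (intro mid) blast+
    moreover have "midpoint (c + y) (c + z) = c + x"
      unfolding yz(3) midpoint_eq_iff
      by (simp add: midpoint_def algebra_simps flip: scaleR_add_left)
    ultimately show "c + x \<in> T" by simp
  qed
  moreover have "open ((+) c ` V)"
    using V(1) by (rule open_translation)
  ultimately show ?thesis
    using V(2) interior_maximal by blast
qed

section \<open>Closed balls as witnesses\<close>

text \<open>The open ball is dense in the closed one, so \<open>U\<close> contains a non-empty open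
  set of the whole space.\<close>

lemma affine_hull_openin_cball:
  fixes a :: "'a::euclidean_space"
  assumes "r > 0" "openin (top_of_set (cball a r)) U" "U \<noteq> {}"
  shows "affine hull U = UNIV"
proof -
  obtain W where W: "open W" "U = cball a r \<inter> W"
    using assms(2) by (auto simp: openin_open)
  then have "W \<inter> closure (ball a r) \<noteq> {}"
    using assms(1,3) by auto
  then have "W \<inter> ball a r \<noteq> {}"
    using W(1) open_Int_closure_eq_empty by blast
  then have "affine hull (W \<inter> ball a r) = UNIV"
    using W(1) by (intro affine_hull_open) auto
  moreover have "W \<inter> ball a r \<subseteq> U"
    using W(2) by auto
  ultimately show ?thesis
    using hull_mono by blast
qed

lemma Polish_space_closed:
  fixes S :: "'a::{complete_space, second_countable_topology} set"
  assumes "closed S"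
  shows "Polish_space (top_of_set S)"
proof -
  obtain \<V> :: "'a set set" where "countable \<V>" "topological_basis \<V>"
    using ex_countable_basis by blast
  then have "second_countable (euclidean :: 'a topology)"
    unfolding second_countable_def open_openin[symmetric]
    by (meson topological_basisE topological_basis_open)
  moreover have "completely_metrizable_space (top_of_set S)"
    using assms completely_metrizable_space_euclidean
    by (intro completely_metrizable_space_closedin) auto
  ultimately show ?thesis
    by (simp add: Polish_space_def second_countable_subtopology)
qed

text \<open>A closed subspace of a complete space is completely metrizable, so Baire's theorem holds
  in it.\<close>

lemma not_meager_in_closed:
  fixes S :: "'a::complete_space set"
  assumes "closed S" "S \<noteq> {}"
  shows "\<not> meager_in (top_of_set S) S"
proof
  let ?X = "top_of_set S"
  assume "meager_in ?X S"
  then obtain \<N> where \<N>: "countable \<N>" "\<And>N. N \<in> \<N> \<Longrightarrow> nowhere_dense_in ?X N" "S = \<Union>\<N>"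
    unfolding meager_in_def by blast
  have "completely_metrizable_space ?X"
    using assms completely_metrizable_space_euclidean
    by (intro completely_metrizable_space_closedin) auto
  then have "?X interior_of \<Union>((closure_of) ?X ` \<N>) = {}"
    using \<N>(1,2) by (intro Baire_category_alt) (auto simp: nowhere_dense_in_def)
  moreover have "S \<subseteq> \<Union>((closure_of) ?X ` \<N>)"
    using \<N>(2,3) closure_of_subset unfolding nowhere_dense_in_def by fast
  then have "S \<subseteq> ?X interior_of \<Union>((closure_of) ?X ` \<N>)"
    by (intro interior_of_maximal) auto
  ultimately show False
    using assms(2) by blast
qed

theorem corollary3:
  fixes D :: "(real ^ 'n) set" and f :: "real ^ 'n \<Rightarrow> real"
  assumes "D \<noteq> {}" and "open D" and "convex D" and "mid_convex_on D f"
  shows "(continuous_on D f \<longleftrightarrow>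
           (\<exists>K. K \<subseteq> D \<and> continuum K \<and> \<not> flat K \<and> bdd_above (f ` K)))
       \<and> (continuous_on D f \<longleftrightarrow>
           (\<exists>K A. K \<subseteq> D \<and> nowhere_flat K \<and> locally connected K
              \<and> A \<subseteq> K \<and> analytic_set A \<and> \<not> meager_in (top_of_set K) A
              \<and> bdd_above (f ` A)))"
proof -
  define T where "T M = {x \<in> D. f x \<le> M}" for M
  have mid: "midpoint x y \<in> T M" if "x \<in> T M" "y \<in> T M" for x y M
  proof -
    have "midpoint x y \<in> D"
      using that \<open>convex D\<close> closed_segment_subset[of x D y] midpoint_in_closed_segment[of x y]
      unfolding T_def by blast
    moreover have "f (midpoint x y) \<le> (f x + f y) / 2"
      using that assms(4) unfolding T_def mid_convex_on_def by blast
    ultimately show ?thesis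
      using that unfolding T_def by auto
  qed
  have cont: "continuous_on D f" if "interior (T M) \<noteq> {}" for M
  proof (rule Bernstein_Doetsch[OF assms(2-4) open_interior that])
    show "interior (T M) \<subseteq> D"
      using interior_subset unfolding T_def by blast
    show "bdd_above (f ` interior (T M))"
      using interior_subset[of "T M"] unfolding T_def by (intro bdd_aboveI[of _ M]) auto
  qed
  have bounded: "\<exists>M. S \<subseteq> T M" if "S \<subseteq> D" "bdd_above (f ` S)" for S
    using that unfolding T_def bdd_above_def by fastforce
  \<comment> \<open>A closed ball in \<open>D\<close> witnesses both conditions, with
    \<open>A = K\<close> in the second; a continuous \<open>f\<close> is bounded on it by
    compactness.\<close>
  obtain a r where r: "r > 0" "cball a r \<subseteq> D"
    using assms(1,2) open_contains_cball by blast
  have bdd: "bdd_above (f ` cball a r)" if "continuous_on D f"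
    using that r(2)
    by (intro bounded_imp_bdd_above compact_imp_bounded compact_continuous_image)
      (auto intro: continuous_on_subset)
  have "nowhere_flat (cball a r)"
    using r(1) affine_hull_openin_cball unfolding nowhere_flat_def not_flat_iff by blast
  moreover have "analytic_set (cball a r)"
    using Polish_space_closed[of "cball a r"] by (intro analytic_setI[where g = id]) auto
  moreover have "\<not> meager_in (top_of_set (cball a r)) (cball a r)"
    using r(1) by (intro not_meager_in_closed) auto
  moreover have "locally connected (cball a r)"
    by (intro convex_imp_locally_connected convex_cball)
  moreover have "\<not> flat (cball a r)" "continuum (cball a r)"
    using r(1) affine_hull_openin_cball[of r a "cball a r"] by (simp_all add: not_flat_iff continuum_def)
  ultimately have fwd:
    "\<exists>K. K \<subseteq> D \<and> continuum K \<and> \<not> flat K \<and> bdd_above (f ` K)"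
    "\<exists>K A. K \<subseteq> D \<and> nowhere_flat K \<and> locally connected K
      \<and> A \<subseteq> K \<and> analytic_set A \<and> \<not> meager_in (top_of_set K) A \<and> bdd_above (f ` A)"
    if "continuous_on D f"
    using r(2) bdd[OF that] by blast+
  have bwd1: "continuous_on D f"
    if "\<exists>K. K \<subseteq> D \<and> continuum K \<and> \<not> flat K \<and> bdd_above (f ` K)"
    using that bounded cont interior_midpoint_closed_continuum[OF mid] by metis
  have bwd2: "continuous_on D f"
    if ex: "\<exists>K A. K \<subseteq> D \<and> nowhere_flat K \<and> locally connected K
      \<and> A \<subseteq> K \<and> analytic_set A \<and> \<not> meager_in (top_of_set K) A \<and> bdd_above (f ` A)"
  proof -
    obtain K A where KA: "K \<subseteq> D" "nowhere_flat K" "locally connected K" "A \<subseteq> K" "analytic_set A"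
      "\<not> meager_in (top_of_set K) A" "bdd_above (f ` A)"
      using ex by blast
    obtain M where "A \<subseteq> T M"
      using bounded KA(1,4,7) by (meson order.trans)
    then show ?thesis
      using interior_midpoint_closed_analytic[OF mid KA(2-4) _ KA(5,6)] cont by blast
  qed
  show ?thesis
    by (intro conjI iffI) (erule fwd bwd1 bwd2)+
qed

end
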